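(* Let $G$ be a finite simple graph and let $\overline{X}_G$ be its Kromatic symmetric function. For each of the following graphs $H$ on 5 vertices, the number of induced subgraphs of $G$ isomorphic to $H$ can be computed from $\overline{X}_G$ (i.e., any two graphs with the same Kromatic symmetric function have the same number of induced copies of $H$): the edgeless graph $\overline{K_5}$; $K_2 \sqcup 3K_1$; $P_3 \sqcup 2K_1$; $2K_2 \sqcup K_1$; $K_{1,3} \sqcup K_1$; the star $K_{1,4}$; the complete tripartite graph $K_{1,1,3}$; $K_3 \sqcup K_2$; the cricket (a triangle with two pendant vertices both attached to the same triangle vertex); the path $P_5$; and $P_3 \sqcup K_2$. Moreover, the numbers of induced copies in $G$ of the remaining 23 (isomorphism classes of) graphs on 5 vertices satisfy a system of 14 linear equations whose coefficients and right-hand sides are determined by $\overline{X}_G$. Also, if $T$ is a tree, then for every graph $H$ on 4 or 5 vertices, the number of induced subgraphs of $T$ isomorphic to $H$ can be determined from $\overline{X}_T$.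
   Context: All graphs are finite and simple. A proper set coloring of $G$ is a function $\kappa: V(G) \to 2^{\mathbb{N}} \setminus \{\varnothing\}$ (where $\mathbb{N}=\{1,2,3,\dots\}$) such that $\kappa(v) \cap \kappa(w) = \varnothing$ whenever $vw \in E(G)$. The Kromatic symmetric function of $G$ is $\overline{X}_G := \sum_{\kappa} \prod_{v \in V(G)} \prod_{i \in \kappa(v)} x_i$, the sum over all proper set colorings $\kappa$ of $G$. $\sqcup$ denotes disjoint union, $mK_1$ denotes $m$ isolated vertices, $P_k$ is the path on $k$ vertices, $K_{1,m}$ is the star with $m$ leaves, and $K_{1,1,3}$ is the complete tripartite graph with parts of sizes 1, 1, 3. *)

theory Defs
  imports Complex_Main "HOL-Library.FuncSet" "HOL-Library.Poly_Mapping"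
begin

type_synonym 'a graph = "'a set \<times> 'a set set"

abbreviation verts :: "'a graph \<Rightarrow> 'a set" where "verts \<equiv> fst"
abbreviation edges :: "'a graph \<Rightarrow> 'a set set" where "edges \<equiv> snd"

definition simple_graph :: "'a graph \<Rightarrow> bool" where
  "simple_graph G \<longleftrightarrow> finite (verts G) \<and> (\<forall>e\<in>edges G. e \<subseteq> verts G \<and> card e = 2)"

definition graph_iso :: "'a graph \<Rightarrow> 'b graph \<Rightarrow> bool" where
  "graph_iso G H \<longleftrightarrow> (\<exists>f. bij_betw f (verts G) (verts H) \<and>
     (\<forall>u\<in>verts G. \<forall>v\<in>verts G. {u, v} \<in> edges G \<longleftrightarrow> {f u, f v} \<in> edges H))"

definition induced_subgraph :: "'a graph \<Rightarrow> 'a set \<Rightarrow> 'a graph" where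
  "induced_subgraph G U = (U, {e \<in> edges G. e \<subseteq> U})"

definition num_induced :: "'b graph \<Rightarrow> 'a graph \<Rightarrow> nat" where
  "num_induced H G = card {U. U \<subseteq> verts G \<and> graph_iso (induced_subgraph G U) H}"


section \<open>The Kromatic symmetric function\<close>

definition proper_set_colorings :: "'a graph \<Rightarrow> ('a \<Rightarrow> nat set) set" where
  "proper_set_colorings G =
     {\<kappa> \<in> verts G \<rightarrow>\<^sub>E (Pow {1..} - {{}}). \<forall>u v. {u, v} \<in> edges G \<longrightarrow> \<kappa> u \<inter> \<kappa> v = {}}"

text \<open>A monomial in the variables \<open>x\<^sub>1, x\<^sub>2, \<dots>\<close> is represented by its exponent vector, so
  the product of variables becomes a sum of unit vectors.\<close>

definition coloring_monomial :: "'a graph \<Rightarrow> ('a \<Rightarrow> nat set) \<Rightarrow> (nat \<Rightarrow>\<^sub>0 nat)" where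
  "coloring_monomial G \<kappa> = (\<Sum>v\<in>verts G. \<Sum>i\<in>\<kappa> v. Poly_Mapping.single i 1)"

text \<open>A formal power series in infinitely many variables is represented by its coefficient
  function: the coefficient of \<open>m\<close> is the number of proper set colorings with monomial \<open>m\<close>.
  Colorings using an infinite color set yield no monomial of finite degree and do not
  contribute; the finiteness condition excludes them explicitly because \<open>sum\<close> over an infinite
  set is \<open>0\<close>.\<close>

definition kromatic :: "'a graph \<Rightarrow> (nat \<Rightarrow>\<^sub>0 nat) \<Rightarrow> nat" where
  "kromatic G m = card {\<kappa> \<in> proper_set_colorings G.
     (\<forall>v\<in>verts G. finite (\<kappa> v)) \<and> coloring_monomial G \<kappa> = m}"

lemma finite_colorings_of_monomial:
  assumes "finite (verts G)"
  shows "finite {\<kappa> \<in> proper_set_colorings G.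
     (\<forall>v\<in>verts G. finite (\<kappa> v)) \<and> coloring_monomial G \<kappa> = m}"
proof (rule finite_subset)
  show "finite (verts G \<rightarrow>\<^sub>E Pow (Poly_Mapping.keys m))"
    using assms by (intro finite_PiE) auto
  show "{\<kappa> \<in> proper_set_colorings G. (\<forall>v\<in>verts G. finite (\<kappa> v)) \<and> coloring_monomial G \<kappa> = m}
    \<subseteq> verts G \<rightarrow>\<^sub>E Pow (Poly_Mapping.keys m)"
  proof (clarify, rule PiE_I)
    fix \<kappa> v
    assume \<kappa>: "\<kappa> \<in> proper_set_colorings G" and fin: "\<forall>v\<in>verts G. finite (\<kappa> v)"
    show "\<kappa> v = undefined" if "v \<notin> verts G"
      using \<kappa> that by (auto simp: proper_set_colorings_def PiE_def extensional_def)
    assume v: "v \<in> verts G"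
    have "i \<in> Poly_Mapping.keys (coloring_monomial G \<kappa>)" if i: "i \<in> \<kappa> v" for i
    proof -
      have "1 \<le> (\<Sum>j\<in>\<kappa> v. Poly_Mapping.lookup (Poly_Mapping.single j (1::nat)) i)"
        using member_le_sum[of i "\<kappa> v" "\<lambda>j. Poly_Mapping.lookup (Poly_Mapping.single j (1::nat)) i"]
          i v fin by simp
      also have "\<dots> \<le> Poly_Mapping.lookup (coloring_monomial G \<kappa>) i"
        unfolding coloring_monomial_def lookup_sum
        using member_le_sum[of v "verts G"
            "\<lambda>v. \<Sum>j\<in>\<kappa> v. Poly_Mapping.lookup (Poly_Mapping.single j (1::nat)) i"] v assms
        by (simp add: lookup_sum)
      finally show ?thesis
        by (simp add: in_keys_iff)
    qed
    then show "\<kappa> v \<in> Pow (Poly_Mapping.keys (coloring_monomial G \<kappa>))"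
      by blast
  qed
qed


section \<open>Trees\<close>

definition connected_graph :: "'a graph \<Rightarrow> bool" where
  "connected_graph G \<longleftrightarrow> verts G \<noteq> {} \<and>
     (\<forall>u\<in>verts G. \<forall>v\<in>verts G. (u, v) \<in> {(x, y). {x, y} \<in> edges G}\<^sup>*)"

definition is_cycle :: "'a graph \<Rightarrow> 'a list \<Rightarrow> bool" where
  "is_cycle G vs \<longleftrightarrow> 3 \<le> length vs \<and> distinct vs \<and>
     (\<forall>i<length vs. {vs ! i, vs ! (Suc i mod length vs)} \<in> edges G)"

definition tree :: "'a graph \<Rightarrow> bool" where
  "tree G \<longleftrightarrow> simple_graph G \<and> connected_graph G \<and> (\<nexists>vs. is_cycle G vs)"


section \<open>Particular graphs\<close>

definition edgeless_graph :: "nat \<Rightarrow> nat graph" where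
  "edgeless_graph n = ({..<n}, {})"

definition complete_graph :: "nat \<Rightarrow> nat graph" where
  "complete_graph n = ({..<n}, {{i, j} | i j. i < n \<and> j < n \<and> i \<noteq> j})"

definition path_graph :: "nat \<Rightarrow> nat graph" where
  "path_graph n = ({..<n}, {{i, Suc i} | i. Suc i < n})"

definition star_graph :: "nat \<Rightarrow> nat graph" where
  "star_graph m = ({..m}, {{0, i} | i. 1 \<le> i \<and> i \<le> m})"

definition complete_tripartite_graph :: "nat \<Rightarrow> nat \<Rightarrow> nat \<Rightarrow> nat graph" where
  "complete_tripartite_graph a b c =
     (let part = (\<lambda>i. if i < a then 0 else if i < a + b then 1 else (2::nat)) in
       ({..<a + b + c}, {{i, j} | i j. i < a + b + c \<and> j < a + b + c \<and> part i \<noteq> part j}))"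

definition cricket_graph :: "nat graph" where
  "cricket_graph = ({..<5}, {{0, 1}, {0, 2}, {1, 2}, {0, 3}, {0, 4}})"

text \<open>The vertices of the first graph are moved to the even numbers, those of the second graph
  to the odd numbers.\<close>

definition disjoint_union :: "nat graph \<Rightarrow> nat graph \<Rightarrow> nat graph" (infixr \<open>\<squnion>\<^sub>g\<close> 65) where
  "G \<squnion>\<^sub>g H =
     ((\<lambda>v. 2 * v) ` verts G \<union> (\<lambda>v. 2 * v + 1) ` verts H,
      (`) (\<lambda>v. 2 * v) ` edges G \<union> (`) (\<lambda>v. 2 * v + 1) ` edges H)"

definition determined_graphs :: "nat graph set" where
  "determined_graphs =
     {edgeless_graph 5,
      complete_graph 2 \<squnion>\<^sub>g edgeless_graph 3,
      path_graph 3 \<squnion>\<^sub>g edgeless_graph 2,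
      (complete_graph 2 \<squnion>\<^sub>g complete_graph 2) \<squnion>\<^sub>g edgeless_graph 1,
      star_graph 3 \<squnion>\<^sub>g edgeless_graph 1,
      star_graph 4,
      complete_tripartite_graph 1 1 3,
      complete_graph 3 \<squnion>\<^sub>g complete_graph 2,
      cricket_graph,
      path_graph 5,
      path_graph 3 \<squnion>\<^sub>g complete_graph 2}"


section \<open>Isomorphism classes of graphs on five vertices\<close>

definition graphs5 :: "nat graph set" where
  "graphs5 = {H. simple_graph H \<and> verts H = {..<5}}"

definition graph_classes5 :: "nat graph set set" where
  "graph_classes5 = graphs5 // {(H, K). H \<in> graphs5 \<and> K \<in> graphs5 \<and> graph_iso H K}"

definition remaining_classes5 :: "nat graph set set" where
  "remaining_classes5 =
     {C \<in> graph_classes5. \<forall>H\<in>C. \<forall>K\<in>determined_graphs. \<not> graph_iso H K}"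

definition num_induced_class :: "nat graph set \<Rightarrow> 'a graph \<Rightarrow> nat" where
  "num_induced_class C G =
     card {U. U \<subseteq> verts G \<and> (\<exists>H\<in>C. graph_iso (induced_subgraph G U) H)}"

end

theory Submission
  imports Defs
begin

text \<open>
  For a vertex set \<open>S\<close> let \<open>i\<^sub>k(S)\<close> be the number of stable \<open>k\<close>-sets inside \<open>S\<close>. A proper set
  coloring with monomial \<open>x\<^sub>1\<^sup>a \<cdots> x\<^sub>r\<^sup>z\<close> is a tuple of stable sets of sizes \<open>a, \<dots>, z\<close> covering
  \<open>V\<close>, so inclusion-exclusion gives the coefficient as
  \<open>\<Sum>S\<subseteq>V. (-1)\<^bsup>|V - S|\<^esup> i\<^sub>a(S) \<cdots> i\<^sub>z(S)\<close>. All mixed moments of the sequences \<open>i(S)\<close> being known,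
  interpolation yields for each sequence \<open>p\<close> the signed number of \<open>S\<close> with \<open>i(S) = p\<close>; the sign
  depends only on \<open>p 1 = |S|\<close>, hence the Kromatic symmetric function determines the multiset of
  independence polynomials of all induced subgraphs.

  Each of the eleven determined graphs is separated from every other graph on five vertices by
  \<open>(i\<^sub>2, i\<^sub>3)\<close> alone, and so are any two forests on four or on five vertices. On the remaining
  23 classes \<open>(i\<^sub>2, i\<^sub>3)\<close> takes ten values, giving ten equations. Four more come from
  counting the 4-subsets \<open>W\<close> with \<open>i\<^sub>2(W) = j\<close> for \<open>j = 0, \<dots>, 3\<close>, each of which lies in \<open>n - 4\<close>
  5-subsets.
\<close>

section \<open>The Kromatic symmetric function and stable sets\<close>

definition stable_set :: "'a graph \<Rightarrow> 'a set \<Rightarrow> bool" where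
  "stable_set G J \<longleftrightarrow> (\<forall>e\<in>edges G. \<not> e \<subseteq> J)"

definition stable_count :: "'a graph \<Rightarrow> 'a set \<Rightarrow> nat \<Rightarrow> nat" where
  "stable_count G S k = card {J. J \<subseteq> S \<and> card J = k \<and> stable_set G J}"

text \<open>Exponents of a monomial are positive, so no moment reads coordinate \<open>0\<close>.
  All sequences of stable counts agree there, hence two different ones already differ at a positive
  index.\<close>

lemma stable_count_0:
  assumes "simple_graph G" "finite S"
  shows "stable_count G S 0 = 1"
proof -
  have "{J. J \<subseteq> S \<and> card J = 0 \<and> stable_set G J} = {{}}"
    using assms by (fastforce simp: stable_set_def simple_graph_def dest: finite_subset)
  then show ?thesis by (simp add: stable_count_def)
qed

text \<open>Conditions on the size of a vertex set thereby become conditions on its sequence, and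
  the inclusion-exclusion sign becomes a function of the sequence.\<close>

lemma stable_count_1:
  assumes "simple_graph G" "finite S"
  shows "stable_count G S 1 = card S"
proof -
  have "stable_set G {v}" for v
    unfolding stable_set_def
  proof (intro ballI notI)
    fix e assume e: "e \<in> edges G" "e \<subseteq> {v}"
    then have "card e \<le> 1" using card_mono[of "{v}" e] by simp
    with e assms(1) show False by (auto simp: simple_graph_def)
  qed
  then have "{J. J \<subseteq> S \<and> card J = 1 \<and> stable_set G J} = (\<lambda>v. {v}) ` S"
    by (auto simp: card_1_singleton_iff)
  then show ?thesis by (simp add: stable_count_def card_image)
qed

lemma simple_graph_edgeE:
  assumes "simple_graph G" "e \<in> edges G"
  obtains u v where "e = {u, v}" "u \<in> verts G" "v \<in> verts G" "u \<noteq> v"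
  using assms by (fastforce simp: simple_graph_def card_2_iff)

section \<open>Set colorings as covers by stable sets\<close>

lemma lookup_coloring_monomial:
  assumes "finite (verts G)" "\<And>v. v \<in> verts G \<Longrightarrow> finite (\<kappa> v)"
  shows "Poly_Mapping.lookup (coloring_monomial G \<kappa>) i = card {v \<in> verts G. i \<in> \<kappa> v}"
proof -
  have "Poly_Mapping.lookup (coloring_monomial G \<kappa>) i = (\<Sum>v\<in>verts G. if i \<in> \<kappa> v then 1 else 0)"
    unfolding coloring_monomial_def lookup_sum
    by (intro sum.cong refl) (simp add: lookup_single when_def assms)
  also have "\<dots> = card {v \<in> verts G. i \<in> \<kappa> v}"
    using assms(1) by (simp add: sum.If_cases Int_def)
  finally show ?thesis .
qed

text \<open>A proper set coloring transposed: \<open>I i\<close> is the class of vertices that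
  receive color \<open>i\<close>. Covering all vertices expresses that no vertex has an empty color
  set.\<close>

definition stable_covers :: "'a graph \<Rightarrow> (nat \<Rightarrow>\<^sub>0 nat) \<Rightarrow> (nat \<Rightarrow> 'a set) set" where
  "stable_covers G m =
     {I \<in> (\<Pi>\<^sub>E i\<in>Poly_Mapping.keys m. {J. J \<subseteq> verts G \<and> card J = Poly_Mapping.lookup m i
         \<and> stable_set G J}).
       (\<Union>i\<in>Poly_Mapping.keys m. I i) = verts G}"

text \<open>Passing from the color sets of the vertices to the color classes is invertible. The
  condition on \<open>0\<close> reflects that colors start at \<open>1\<close>.\<close>

lemma kromatic_eq_card_stable_covers:
  assumes G: "simple_graph G" and m: "0 \<notin> Poly_Mapping.keys m"
  shows "kromatic G m = card (stable_covers G m)"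
proof -
  let ?K = "Poly_Mapping.keys m" and ?V = "verts G"
  have fin: "finite ?V" using G by (simp add: simple_graph_def)
  let ?C = "{\<kappa> \<in> proper_set_colorings G. (\<forall>v\<in>?V. finite (\<kappa> v)) \<and> coloring_monomial G \<kappa> = m}"
  let ?classes = "\<lambda>\<kappa>. \<lambda>i\<in>?K. {v \<in> ?V. i \<in> \<kappa> v}"
  let ?coloring = "\<lambda>I. \<lambda>v\<in>?V. {i \<in> ?K. v \<in> I i}"
  have card_classes: "card {v \<in> ?V. i \<in> \<kappa> v} = Poly_Mapping.lookup m i" if "\<kappa> \<in> ?C" for \<kappa> i
    using lookup_coloring_monomial[OF fin, of \<kappa> i] that by auto
  \<comment> \<open>A color used at \<open>v\<close> has a nonempty class, so its exponent in
    \<open>m\<close> is positive.\<close>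
  have colors: "\<kappa> v \<subseteq> ?K" if \<kappa>: "\<kappa> \<in> ?C" and v: "v \<in> ?V" for \<kappa> v
    using card_classes[OF \<kappa>, symmetric] v fin by (auto simp: in_keys_iff)
  have "bij_betw ?classes ?C (stable_covers G m)"
  proof (rule bij_betw_byWitness[where f' = ?coloring])
    show "\<forall>\<kappa>\<in>?C. ?coloring (?classes \<kappa>) = \<kappa>"
    proof (intro ballI ext)
      fix \<kappa> v assume \<kappa>: "\<kappa> \<in> ?C"
      then show "?coloring (?classes \<kappa>) v = \<kappa> v"
        using colors[OF \<kappa>, of v]
        by (cases "v \<in> ?V") (auto simp: proper_set_colorings_def PiE_def extensional_def)
    qed
    show "\<forall>I\<in>stable_covers G m. ?classes (?coloring I) = I"
      by (intro ballI ext) (auto simp: stable_covers_def PiE_def extensional_def restrict_def)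
    show "?classes ` ?C \<subseteq> stable_covers G m"
    proof (rule image_subsetI)
      fix \<kappa> assume \<kappa>: "\<kappa> \<in> ?C"
      have "stable_set G {v \<in> ?V. i \<in> \<kappa> v}" for i
        unfolding stable_set_def
      proof (intro ballI notI)
        fix e assume e: "e \<in> edges G" "e \<subseteq> {v \<in> ?V. i \<in> \<kappa> v}"
        then obtain u v where "e = {u, v}" using G by (blast elim: simple_graph_edgeE)
        moreover from \<kappa> have "\<forall>u v. {u, v} \<in> edges G \<longrightarrow> \<kappa> u \<inter> \<kappa> v = {}"
          by (simp add: proper_set_colorings_def)
        ultimately show False using e by blast
      qed
      moreover have "(\<Union>i\<in>?K. {v \<in> ?V. i \<in> \<kappa> v}) = ?V"
      proof -
        have "\<exists>i\<in>?K. i \<in> \<kappa> v" if "v \<in> ?V" for v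
        proof -
          have "\<kappa> v \<noteq> {}" using \<kappa> that by (auto simp: proper_set_colorings_def PiE_def Pi_def)
          with colors[OF \<kappa> that] show ?thesis by blast
        qed
        then show ?thesis by blast
      qed
      ultimately show "?classes \<kappa> \<in> stable_covers G m"
        using card_classes[OF \<kappa>] by (auto simp: stable_covers_def)
    qed
    show "?coloring ` stable_covers G m \<subseteq> ?C"
    proof (rule image_subsetI)
      fix I assume I: "I \<in> stable_covers G m"
      then have sub: "I i \<subseteq> ?V" "card (I i) = Poly_Mapping.lookup m i" "stable_set G (I i)"
        if "i \<in> ?K" for i using that by (auto simp: stable_covers_def PiE_def Pi_def)
      from I have cov: "(\<Union>i\<in>?K. I i) = ?V" by (simp add: stable_covers_def)
      have "?coloring I \<in> ?V \<rightarrow>\<^sub>E (Pow {1..} - {{}})"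
      proof (rule restrict_PiE_iff[THEN iffD2], intro ballI)
        fix v assume "v \<in> ?V"
        then obtain i where "i \<in> ?K" "v \<in> I i" using cov by blast
        moreover have "i \<ge> 1" if "i \<in> ?K" for i using that m by (cases i) auto
        ultimately show "{i \<in> ?K. v \<in> I i} \<in> Pow {1..} - {{}}" by auto
      qed
      moreover have "?coloring I u \<inter> ?coloring I v = {}" if "{u, v} \<in> edges G" for u v
      proof -
        have "u \<in> ?V" "v \<in> ?V" using that G by (auto simp: simple_graph_def)
        then show ?thesis using sub(3)[unfolded stable_set_def] that by fastforce
      qed
      ultimately have "?coloring I \<in> proper_set_colorings G"
        by (simp add: proper_set_colorings_def)
      moreover have "coloring_monomial G (?coloring I) = m"
      proof (rule poly_mapping_eqI)
        fix i
        have "Poly_Mapping.lookup (coloring_monomial G (?coloring I)) i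
          = card {v \<in> ?V. i \<in> ?K \<and> v \<in> I i}"
          by (subst lookup_coloring_monomial[OF fin]) (auto intro!: arg_cong[where f = card])
        also have "\<dots> = Poly_Mapping.lookup m i"
        proof (cases "i \<in> ?K")
          case True
          then have "{v \<in> ?V. i \<in> ?K \<and> v \<in> I i} = I i" using sub(1) by auto
          with True sub(2) show ?thesis by simp
        next
          case False
          then show ?thesis by (simp add: in_keys_iff)
        qed
        finally show "Poly_Mapping.lookup (coloring_monomial G (?coloring I)) i
          = Poly_Mapping.lookup m i" .
      qed
      ultimately show "?coloring I \<in> ?C" by simp
    qed
  qed
  then show ?thesis
    unfolding kromatic_def by (rule bij_betw_same_card)
qed

section \<open>Inclusion-exclusion over vertex subsets\<close>

lemma sum_signed_supersets:
  assumes "finite V" "U \<subseteq> V"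
  shows "(\<Sum>S\<in>Pow V. if U \<subseteq> S then (- 1) ^ card (V - S) else 0) = (if U = V then 1 else 0 :: real)"
proof -
  have "(\<Sum>S\<in>Pow V. if U \<subseteq> S then (- 1) ^ card (V - S) else 0 :: real)
    = (\<Sum>S\<in>{S. U \<subseteq> S \<and> S \<subseteq> V}. (- 1) ^ card (V - S))"
    using assms(1) by (intro sum.mono_neutral_cong_right) auto
  \<comment> \<open>\<open>D\<close> is the complement of \<open>S\<close>. The signed sum over all
    \<open>D\<close> is the expansion of a product of factors \<open>-1 + 1\<close>, which vanishes
    unless \<open>V - U\<close> is empty.\<close>
  also have "\<dots> = (\<Sum>D\<in>Pow (V - U). (- 1) ^ card D)"
    using assms by (intro sum.reindex_bij_witness[of _ "\<lambda>D. V - D" "\<lambda>S. V - S"])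
      (auto simp: double_diff)
  also have "\<dots> = (\<Prod>v\<in>V - U. - 1 + 1 :: real)"
    using assms(1) prod_add[of "V - U" "\<lambda>_. - 1 :: real" "\<lambda>_. 1"] by simp
  also have "\<dots> = (if U = V then 1 else 0)"
    using assms by (auto simp: power_0_left)
  finally show ?thesis .
qed

text \<open>The covering condition is replaced by a signed sum over the sets \<open>S\<close> that
  contain the union of the chosen stable sets. After the sums are exchanged, the stable sets inside
  a fixed \<open>S\<close> are chosen independently, one factor per color.\<close>

lemma card_stable_covers:
  assumes G: "simple_graph G"
  shows "real (card (stable_covers G m)) = (\<Sum>S\<in>Pow (verts G). (- 1) ^ card (verts G - S) *
           (\<Prod>i\<in>Poly_Mapping.keys m. real (stable_count G S (Poly_Mapping.lookup m i))))"
proof -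
  let ?K = "Poly_Mapping.keys m" and ?V = "verts G"
  have fin: "finite ?V" using G by (simp add: simple_graph_def)
  define P where "P S = (\<Pi>\<^sub>E i\<in>?K. {J. J \<subseteq> S \<and> card J = Poly_Mapping.lookup m i
      \<and> stable_set G J})" for S
  have finP: "finite (P ?V)"
    unfolding P_def using fin by (intro finite_PiE) auto
  have "real (card (stable_covers G m)) = (\<Sum>I\<in>P ?V. if (\<Union>i\<in>?K. I i) = ?V then 1 else 0)"
    using finP by (simp add: sum.If_cases stable_covers_def P_def[symmetric] Int_def)
  also have "\<dots> = (\<Sum>I\<in>P ?V. \<Sum>S\<in>Pow ?V. if (\<Union>i\<in>?K. I i) \<subseteq> S then (- 1) ^ card (?V - S) else 0)"
  proof (rule sum.cong[OF refl])
    fix I assume "I \<in> P ?V"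
    then have "(\<Union>i\<in>?K. I i) \<subseteq> ?V" by (auto simp: P_def PiE_def Pi_def)
    then show "(if (\<Union>i\<in>?K. I i) = ?V then 1 else 0) =
        (\<Sum>S\<in>Pow ?V. if (\<Union>i\<in>?K. I i) \<subseteq> S then (- 1) ^ card (?V - S) else 0 :: real)"
      using sum_signed_supersets[OF fin] by simp
  qed
  also have "\<dots> = (\<Sum>S\<in>Pow ?V. \<Sum>I\<in>P ?V. if (\<Union>i\<in>?K. I i) \<subseteq> S then (- 1) ^ card (?V - S) else 0)"
    by (rule sum.swap)
  also have "\<dots> = (\<Sum>S\<in>Pow ?V. (- 1) ^ card (?V - S) * real (card (P S)))"
  proof (rule sum.cong[OF refl])
    fix S assume "S \<in> Pow ?V"
    then have "{I \<in> P ?V. (\<Union>i\<in>?K. I i) \<subseteq> S} = P S"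
      by (auto simp: P_def PiE_def Pi_def)
    moreover have "(\<Sum>I\<in>P ?V. if (\<Union>i\<in>?K. I i) \<subseteq> S then (- 1) ^ card (?V - S) else 0)
      = real (card {I \<in> P ?V. (\<Union>i\<in>?K. I i) \<subseteq> S}) * (- 1) ^ card (?V - S)"
      using finP by (simp add: sum.If_cases Int_def)
    ultimately show "(\<Sum>I\<in>P ?V. if (\<Union>i\<in>?K. I i) \<subseteq> S then (- 1) ^ card (?V - S) else 0)
      = (- 1) ^ card (?V - S) * real (card (P S))" by simp
  qed
  finally show ?thesis
    by (simp add: P_def card_PiE stable_count_def)
qed

section \<open>Mixed moments and interpolation\<close>

definition monomial_of_list :: "nat list \<Rightarrow> (nat \<Rightarrow>\<^sub>0 nat)" where
  "monomial_of_list as = (\<Sum>i<length as. Poly_Mapping.single (Suc i) (as ! i))"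

text \<open>Each position of \<open>as\<close> has its own variable, so a repeated value yields a
  power of one stable count and not a larger exponent. Hence every signed mixed moment of the
  sequences occurs as a coefficient.\<close>

lemma kromatic_monomial_of_list:
  assumes G: "simple_graph G" and as: "0 \<notin> set as"
  shows "real (kromatic G (monomial_of_list as)) =
    (\<Sum>S\<in>Pow (verts G). (- 1) ^ card (verts G - S) * (\<Prod>a\<leftarrow>as. real (stable_count G S a)))"
proof -
  let ?m = "monomial_of_list as"
  have lookup: "Poly_Mapping.lookup ?m k = (if k \<in> Suc ` {..<length as} then as ! (k - 1)
      else 0)" for k
  proof (cases k)
    case 0
    then show ?thesis by (auto simp: monomial_of_list_def lookup_sum lookup_single when_def)
  next
    case (Suc j)
    then show ?thesis
      by (auto simp: monomial_of_list_def lookup_sum lookup_single when_def)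
  qed
  have nz: "as ! i \<noteq> 0" if "i < length as" for i
    using as nth_mem[OF that] by metis
  have keys: "Poly_Mapping.keys ?m = Suc ` {..<length as}"
  proof (rule set_eqI)
    show "k \<in> Poly_Mapping.keys ?m \<longleftrightarrow> k \<in> Suc ` {..<length as}" for k
      using nz by (cases k) (auto simp: in_keys_iff lookup simp del: lookup_not_eq_zero_eq_in_keys)
  qed
  have "(\<Prod>i\<in>Poly_Mapping.keys ?m. real (stable_count G S (Poly_Mapping.lookup ?m i)))
    = (\<Prod>a\<leftarrow>as. real (stable_count G S a))" for S
  proof -
    have "(\<Prod>i\<in>Poly_Mapping.keys ?m. real (stable_count G S (Poly_Mapping.lookup ?m i)))
      = (\<Prod>i<length as. real (stable_count G S (as ! i)))"
      by (simp add: keys prod.reindex lookup)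
    also have "\<dots> = (\<Prod>a\<leftarrow>as. real (stable_count G S a))"
      by (simp add: prod.list_conv_set_nth atLeast0LessThan)
    finally show ?thesis .
  qed
  then show ?thesis
    using kromatic_eq_card_stable_covers[OF G, of ?m] card_stable_covers[OF G, of ?m] keys by simp
qed

text \<open>On the finitely many sequences that occur, the indicator of \<open>p\<close> coincides
  with a polynomial in finitely many coordinates, and the signed sum of such a polynomial is a
  combination of mixed moments.\<close>

lemma kromatic_determines_signed_count:
  fixes G :: "'a graph" and G' :: "'b graph" and p :: "nat \<Rightarrow> nat"
  assumes G: "simple_graph G" and G': "simple_graph G'" and eq: "kromatic G = kromatic G'"
    and p: "p 0 = 1"
  shows "(\<Sum>S\<in>Pow (verts G). (- 1) ^ card (verts G - S) * of_bool (stable_count G S = p)) =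
         (\<Sum>S\<in>Pow (verts G'). (- 1) ^ card (verts G' - S) * of_bool (stable_count G' S = p) :: real)"
proof -
  \<comment> \<open>Quantifying over all monomials \<open>as\<close> makes the class of good functions closed under
    multiplication by the coordinates, hence it contains the Lagrange polynomial \<open>L Q\<close> below.\<close>
  define good where "good \<phi> \<longleftrightarrow> (\<forall>as. 0 \<notin> set as \<longrightarrow>
      (\<Sum>S\<in>Pow (verts G). (- 1) ^ card (verts G - S) * (\<Prod>a\<leftarrow>as. real (stable_count G S a))
          * \<phi> (stable_count G S)) =
      (\<Sum>S\<in>Pow (verts G'). (- 1) ^ card (verts G' - S) * (\<Prod>a\<leftarrow>as. real (stable_count G' S a))
          * \<phi> (stable_count G' S)))"
    for \<phi> :: "(nat \<Rightarrow> nat) \<Rightarrow> real"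
  have good_1: "good (\<lambda>_. 1)"
    unfolding good_def
    using kromatic_monomial_of_list[OF G] kromatic_monomial_of_list[OF G'] eq by simp
  \<comment> \<open>Multiplying by coordinate \<open>a\<close> replaces \<open>as\<close> by
    \<open>a # as\<close>, still an admissible list because \<open>a\<close> is positive. The
    constants \<open>c\<close> and \<open>d\<close> give the product the shape of one normalized
    Lagrange factor.\<close>
  have good_mult: "good (\<lambda>q. (real (q a) - c) * d * \<phi> q)" if "good \<phi>" "a \<noteq> 0" for \<phi> a c d
    unfolding good_def
  proof (intro allI impI)
    fix as :: "nat list" assume as: "0 \<notin> set as"
    have expand: "(\<Sum>S\<in>Pow (verts H). (- 1) ^ card (verts H - S)
        * (\<Prod>b\<leftarrow>as. real (stable_count H S b)) *
          ((real (stable_count H S a) - c) * d * \<phi> (stable_count H S)))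
      = d * (\<Sum>S\<in>Pow (verts H). (- 1) ^ card (verts H - S)
          * (\<Prod>b\<leftarrow>a # as. real (stable_count H S b)) * \<phi> (stable_count H S))
        - c * d * (\<Sum>S\<in>Pow (verts H). (- 1) ^ card (verts H - S)
            * (\<Prod>b\<leftarrow>as. real (stable_count H S b)) * \<phi> (stable_count H S))"
      for H :: "'c graph"
      by (simp add: sum_distrib_left sum_subtractf[symmetric] algebra_simps)
    show "(\<Sum>S\<in>Pow (verts G). (- 1) ^ card (verts G - S) * (\<Prod>b\<leftarrow>as. real (stable_count G S b)) *
          ((real (stable_count G S a) - c) * d * \<phi> (stable_count G S))) =
        (\<Sum>S\<in>Pow (verts G'). (- 1) ^ card (verts G' - S) * (\<Prod>b\<leftarrow>as. real (stable_count G' S b)) *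
          ((real (stable_count G' S a) - c) * d * \<phi> (stable_count G' S)))"
      unfolding expand
      using that(1)[unfolded good_def, rule_format, of as] that(1)[unfolded good_def,
          rule_format, of "a # as"]
        as that(2) by (simp only: set_simps insert_iff not_False_eq_True simp_thms)
  qed
  \<comment> \<open>The difference is taken after the union: \<open>Q\<close> holds all occurring
    sequences other than \<open>p\<close>.\<close>
  define Q where "Q = stable_count G ` Pow (verts G) \<union> stable_count G' ` Pow (verts G') - {p}"
  have finV: "finite (verts G)" "finite (verts G')" using G G' by (auto simp: simple_graph_def)
  then have finQ: "finite Q" by (simp add: Q_def)
  have "\<exists>a. a \<noteq> 0 \<and> q a \<noteq> p a" if q: "q \<in> Q" for q
  proof -
    from q have "q 0 = 1" "q \<noteq> p"
      using stable_count_0[OF G] stable_count_0[OF G'] finV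
          by (auto simp: Q_def intro: finite_subset)
    with p show ?thesis by (metis ext)
  qed
  then obtain a where a: "\<And>q. q \<in> Q \<Longrightarrow> a q \<noteq> 0 \<and> q (a q) \<noteq> p (a q)" by metis
  \<comment> \<open>One separating coordinate \<open>a q\<close> per node suffices: the factor of
    \<open>q\<close> is \<open>0\<close> at \<open>r = q\<close> and \<open>1\<close> at
    \<open>r = p\<close>.\<close>
  define L where "L R r = (\<Prod>q\<in>R. (real (r (a q)) - real (q (a q)))
      * (1 / (real (p (a q)) - real (q (a q)))))" for R r
  have "good (L R)" if "finite R" "R \<subseteq> Q" for R
    using that
  proof (induction R)
    case empty
    then show ?case using good_1 by (simp add: L_def)
  next
    case (insert q R)
    then have "good (\<lambda>r. (real (r (a q)) - real (q (a q)))
        * (1 / (real (p (a q)) - real (q (a q)))) * L R r)"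
      using a by (intro good_mult) auto
    moreover have "L (insert q R) = (\<lambda>r. (real (r (a q)) - real (q (a q)))
        * (1 / (real (p (a q)) - real (q (a q)))) * L R r)"
      using insert by (auto simp: L_def)
    ultimately show ?case by simp
  qed
  then have good_L: "good (L Q)" using finQ by simp
  have L: "L Q r = of_bool (r = p)" if "r \<in> insert p Q" for r
  proof (cases "r = p")
    case True
    then show ?thesis using a by (fastforce simp: L_def intro!: prod.neutral)
  next
    case False
    with that have "r \<in> Q" by simp
    then show ?thesis using False finQ by (auto simp: L_def intro!: prod_zero)
  qed
  have "(\<Sum>S\<in>Pow (verts G). (- 1) ^ card (verts G - S) * L Q (stable_count G S)) =
        (\<Sum>S\<in>Pow (verts G'). (- 1) ^ card (verts G' - S) * L Q (stable_count G' S))"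
    using good_L[unfolded good_def, rule_format, of "[]"] by simp
  moreover have "(\<Sum>S\<in>Pow (verts G). (- 1) ^ card (verts G - S) * L Q (stable_count G S)) =
      (\<Sum>S\<in>Pow (verts G). (- 1) ^ card (verts G - S) * of_bool (stable_count G S = p))"
    by (intro sum.cong refl arg_cong2[where f = "(*)"] L) (auto simp: Q_def)
  moreover have "(\<Sum>S\<in>Pow (verts G'). (- 1) ^ card (verts G' - S) * L Q (stable_count G' S)) =
      (\<Sum>S\<in>Pow (verts G'). (- 1) ^ card (verts G' - S) * of_bool (stable_count G' S = p))"
    by (intro sum.cong refl arg_cong2[where f = "(*)"] L) (auto simp: Q_def)
  ultimately show ?thesis by simp
qed

text \<open>A set with sequence \<open>p\<close> has \<open>p 1\<close> elements, so all nonzero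
  terms carry the same sign, and the absolute value removes it.\<close>

lemma signed_count_eq:
  fixes G :: "'a graph"
  assumes G: "simple_graph G"
  shows "\<bar>\<Sum>S\<in>Pow (verts G). (- 1) ^ card (verts G - S) * of_bool (stable_count G S = p) :: real\<bar>
    = real (card {S \<in> Pow (verts G). stable_count G S = p})"
proof -
  have fin: "finite (verts G)" using G by (simp add: simple_graph_def)
  have "(\<Sum>S\<in>Pow (verts G). (- 1) ^ card (verts G - S) * of_bool (stable_count G S = p) :: real)
    = (\<Sum>S\<in>Pow (verts G). (- 1) ^ (card (verts G) - p 1) * of_bool (stable_count G S = p))"
    using fin stable_count_1[OF G]
    by (intro sum.cong refl) (auto simp: card_Diff_subset finite_subset)
  also have "\<dots> = (- 1) ^ (card (verts G) - p 1) * real (card {S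
      \<in> Pow (verts G). stable_count G S = p})"
    using fin by (simp add: sum_distrib_left[symmetric] sum.If_cases of_bool_def Int_def)
  finally show ?thesis by (simp add: abs_mult power_abs)
qed

text \<open>Grouping the subsets by their sequence reduces the claim to equal fiber sizes. An
  arbitrary \<open>\<phi>\<close> serves indicators of isomorphism types as well as weighted
  counts.\<close>

theorem kromatic_determines_stable_counts:
  fixes G :: "'a graph" and G' :: "'b graph" and \<phi> :: "(nat \<Rightarrow> nat) \<Rightarrow> real"
  assumes G: "simple_graph G" and G': "simple_graph G'" and eq: "kromatic G = kromatic G'"
  shows "(\<Sum>S\<in>Pow (verts G). \<phi> (stable_count G S)) = (\<Sum>S\<in>Pow (verts G'). \<phi> (stable_count G' S))"
proof -
  define Q where "Q = stable_count G ` Pow (verts G) \<union> stable_count G' ` Pow (verts G')"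
  have fin: "finite (verts G)" "finite (verts G')" using G G' by (auto simp: simple_graph_def)
  then have finQ: "finite Q" by (simp add: Q_def)
  have Q0: "p 0 = 1" if "p \<in> Q" for p
    using that stable_count_0[OF G] stable_count_0[OF G'] fin
        by (auto simp: Q_def intro: finite_subset)
  have group: "(\<Sum>S\<in>Pow (verts H). \<phi> (stable_count H S)) =
      (\<Sum>p\<in>Q. real (card {S \<in> Pow (verts H). stable_count H S = p}) * \<phi> p)"
    if "finite (verts H)" "stable_count H ` Pow (verts H) \<subseteq> Q" for H :: "'c graph"
    using sum.group[of "Pow (verts H)" Q "stable_count H" "\<lambda>S. \<phi> (stable_count H S)"] that finQ
        by simp
  have "card {S \<in> Pow (verts G). stable_count G S = p} = card {S
      \<in> Pow (verts G'). stable_count G' S = p}"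
    if "p \<in> Q" for p
    using kromatic_determines_signed_count[where p
        = p, OF G G' eq Q0[OF that]] signed_count_eq[OF G, of p] signed_count_eq[OF G', of p]
    by simp
  then show ?thesis
    using group[of G] group[of G'] fin by (simp add: Q_def)
qed

section \<open>Isomorphism invariants\<close>

text \<open>\<open>stable_count G W 2\<close> is the number of nonadjacent pairs in
  \<open>W\<close>. For a five-element \<open>S\<close> this sorts the cards obtained by deleting
  one vertex.\<close>

definition deck_count :: "'a graph \<Rightarrow> 'a set \<Rightarrow> nat \<Rightarrow> nat" where
  "deck_count G S j = card {W. W \<subseteq> S \<and> card W = 4 \<and> stable_count G W 2 = j}"

lemma graph_iso_refl: "graph_iso G G"
  unfolding graph_iso_def by (rule exI[of _ id]) simp

lemma graph_iso_sym:
  assumes "graph_iso G H"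
  shows "graph_iso H G"
proof -
  obtain f where f: "bij_betw f (verts G) (verts H)"
    and e: "\<forall>u\<in>verts G. \<forall>v\<in>verts G. {u, v} \<in> edges G \<longleftrightarrow> {f u, f v} \<in> edges H"
    using assms by (auto simp: graph_iso_def)
  let ?g = "inv_into (verts G) f"
  have g: "bij_betw ?g (verts H) (verts G)" using f by (rule bij_betw_inv_into)
  have "{u, v} \<in> edges H \<longleftrightarrow> {?g u, ?g v} \<in> edges G" if "u \<in> verts H" "v \<in> verts H" for u v
    using e that g f by (simp add: bij_betwE bij_betw_inv_into_right)
  with g show ?thesis unfolding graph_iso_def by blast
qed

lemma graph_iso_trans:
  assumes "graph_iso G H" "graph_iso H K"
  shows "graph_iso G K"
proof -
  obtain f where f: "bij_betw f (verts G) (verts H)"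
    and ef: "\<forall>u\<in>verts G. \<forall>v\<in>verts G. {u, v} \<in> edges G \<longleftrightarrow> {f u, f v} \<in> edges H"
    using assms by (auto simp: graph_iso_def)
  obtain g where g: "bij_betw g (verts H) (verts K)"
    and eg: "\<forall>u\<in>verts H. \<forall>v\<in>verts H. {u, v} \<in> edges H \<longleftrightarrow> {g u, g v} \<in> edges K"
    using assms by (auto simp: graph_iso_def)
  have "bij_betw (g \<circ> f) (verts G) (verts K)" using f g by (rule bij_betw_trans)
  moreover have "{u, v} \<in> edges G \<longleftrightarrow> {(g \<circ> f) u, (g \<circ> f) v} \<in> edges K"
    if "u \<in> verts G" "v \<in> verts G" for u v
    using ef eg that f by (simp add: bij_betwE)
  ultimately show ?thesis unfolding graph_iso_def by blast
qed

lemma graph_iso_card: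
  "graph_iso G H \<Longrightarrow> card (verts G) = card (verts H)"
  unfolding graph_iso_def using bij_betw_same_card by blast

lemma graph_iso_imageI:
  assumes f: "bij_betw f (verts G) (verts H)" and e: "edges H = (`) f ` edges G"
    and sub: "\<And>e. e \<in> edges G \<Longrightarrow> e \<subseteq> verts G"
  shows "graph_iso G H"
proof -
  have "{u, v} \<in> edges G \<longleftrightarrow> {f u, f v} \<in> edges H" if "u \<in> verts G" "v \<in> verts G" for u v
  proof
    assume "{u, v} \<in> edges G"
    then have "f ` {u, v} \<in> edges H" unfolding e by (rule imageI)
    then show "{f u, f v} \<in> edges H" by simp
  next
    assume "{f u, f v} \<in> edges H"
    then obtain d where d: "d \<in> edges G" "f ` {u, v} = f ` d" unfolding e by auto
    then have "{u, v} = d"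
      using inj_on_image_eq_iff[of f "verts G" "{u, v}" d] f that sub by (auto simp: bij_betw_def)
    with d show "{u, v} \<in> edges G" by simp
  qed
  with f show ?thesis unfolding graph_iso_def by blast
qed

lemma stable_set_iff:
  assumes "simple_graph G"
  shows "stable_set G J \<longleftrightarrow> (\<forall>u\<in>J. \<forall>v\<in>J. {u, v} \<notin> edges G)"
proof
  show "\<forall>u\<in>J. \<forall>v\<in>J. {u, v} \<notin> edges G" if "stable_set G J"
    using that by (auto simp: stable_set_def)
  show "stable_set G J" if J: "\<forall>u\<in>J. \<forall>v\<in>J. {u, v} \<notin> edges G"
    unfolding stable_set_def
  proof (intro ballI notI)
    fix e assume "e \<in> edges G" "e \<subseteq> J"
    then show False using J by (metis assms insert_subset simple_graph_edgeE)
  qed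
qed

lemma stable_set_image_iso:
  assumes G: "simple_graph G" and H: "simple_graph H" and f: "bij_betw f (verts G) (verts H)"
    and e: "\<forall>u\<in>verts G. \<forall>v\<in>verts G. {u, v} \<in> edges G \<longleftrightarrow> {f u, f v} \<in> edges H"
    and J: "J \<subseteq> verts G"
  shows "stable_set H (f ` J) \<longleftrightarrow> stable_set G J"
  unfolding stable_set_iff[OF G] stable_set_iff[OF H] using e J by (simp add: subset_iff)

lemma card_subsets_image:
  assumes "inj_on f S" "\<And>J. J \<subseteq> S \<Longrightarrow> Q (f ` J) \<longleftrightarrow> P J"
  shows "card {J. J \<subseteq> f ` S \<and> Q J} = card {J. J \<subseteq> S \<and> P J}"
proof -
  have "{J. J \<subseteq> f ` S \<and> Q J} = (`) f ` {J. J \<subseteq> S \<and> P J}"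
    using assms(2) by (auto simp: subset_image_iff)
  moreover have "inj_on ((`) f) {J. J \<subseteq> S \<and> P J}"
    using assms(1) by (auto intro!: inj_onI simp: inj_on_image_eq_iff)
  ultimately show ?thesis by (simp add: card_image)
qed

lemma stable_count_image_iso:
  assumes "simple_graph G" "simple_graph H" and f: "bij_betw f (verts G) (verts H)"
    and "\<forall>u\<in>verts G. \<forall>v\<in>verts G. {u, v} \<in> edges G \<longleftrightarrow> {f u, f v} \<in> edges H"
    and S: "S \<subseteq> verts G"
  shows "stable_count H (f ` S) = stable_count G S"
proof
  fix k
  have inj: "inj_on f S" using f S by (auto simp: bij_betw_def intro: inj_on_subset)
  then show "stable_count H (f ` S) k = stable_count G S k"
    unfolding stable_count_def
    using stable_set_image_iso[OF assms(1-4)] S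
    by (intro card_subsets_image) (auto simp: card_image inj_on_subset)
qed

lemma graph_iso_counts:
  assumes "simple_graph G" "simple_graph H" "graph_iso G H"
  shows "stable_count G (verts G) = stable_count H (verts H)"
    and "deck_count G (verts G) = deck_count H (verts H)"
proof -
  obtain f where f: "bij_betw f (verts G) (verts H)"
    and e: "\<forall>u\<in>verts G. \<forall>v\<in>verts G. {u, v} \<in> edges G \<longleftrightarrow> {f u, f v} \<in> edges H"
    using assms by (auto simp: graph_iso_def)
  have im: "f ` verts G = verts H" and inj: "inj_on f (verts G)" using f
      by (auto simp: bij_betw_def)
  note count = stable_count_image_iso[OF assms(1,2) f e]
  show "stable_count G (verts G) = stable_count H (verts H)"
    using count[of "verts G"] im by simp
  show "deck_count G (verts G) = deck_count H (verts H)"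
  proof
    show "deck_count G (verts G) j = deck_count H (verts H) j" for j
      unfolding deck_count_def im[symmetric]
      by (rule sym, rule card_subsets_image[OF inj]) (auto simp: count card_image
          inj_on_subset[OF inj])
  qed
qed

lemma is_cycle_iso:
  assumes G: "simple_graph G" and iso: "graph_iso G H" and c: "is_cycle G vs"
  shows "\<exists>ws. is_cycle H ws"
proof -
  obtain f where f: "bij_betw f (verts G) (verts H)"
    and e: "\<forall>u\<in>verts G. \<forall>v\<in>verts G. {u, v} \<in> edges G \<longleftrightarrow> {f u, f v} \<in> edges H"
    using iso by (auto simp: graph_iso_def)
  have step: "{vs ! i, vs ! (Suc i mod length vs)} \<in> edges G" if "i < length vs" for i
    using c that by (simp add: is_cycle_def)
  have verts: "vs ! i \<in> verts G" if "i < length vs" for i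
    using step[OF that] G by (auto simp: simple_graph_def)
  then have "set vs \<subseteq> verts G" by (auto simp: in_set_conv_nth)
  then have "distinct (map f vs)"
    using c f by (auto simp: is_cycle_def distinct_map bij_betw_def intro: inj_on_subset)
  moreover have "{map f vs ! i, map f vs ! (Suc i mod length vs)} \<in> edges H" if "i < length vs"
      for i
  proof -
    have "Suc i mod length vs < length vs" using that by (intro mod_less_divisor) auto
    then show ?thesis using e step[OF that] verts that by simp
  qed
  ultimately have "is_cycle H (map f vs)" using c by (simp add: is_cycle_def)
  then show ?thesis ..
qed

lemma verts_induced_subgraph [simp]: "verts (induced_subgraph G U) = U"
  by (simp add: induced_subgraph_def)

lemma simple_induced_subgraph:
  "simple_graph G \<Longrightarrow> U \<subseteq> verts G \<Longrightarrow> simple_graph (induced_subgraph G U)"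
  by (auto simp: simple_graph_def induced_subgraph_def intro: finite_subset)

lemma stable_count_induced_subgraph:
  assumes "S \<subseteq> U"
  shows "stable_count (induced_subgraph G U) S = stable_count G S"
proof -
  have "stable_set (induced_subgraph G U) J \<longleftrightarrow> stable_set G J" if "J \<subseteq> S" for J
    unfolding stable_set_def induced_subgraph_def using that assms by (simp, meson order_trans)
  then show ?thesis
    by (intro ext) (auto simp: stable_count_def intro!: arg_cong[where f = card])
qed

lemma deck_count_induced_subgraph:
  "deck_count (induced_subgraph G U) U = deck_count G U"
  by (intro ext)
    (auto simp: deck_count_def stable_count_induced_subgraph intro!: arg_cong[where f = card])

lemma is_cycle_induced_subgraph: "is_cycle (induced_subgraph G U) vs \<Longrightarrow> is_cycle G vs"
  by (auto simp: is_cycle_def induced_subgraph_def)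

section \<open>Graphs on at most five vertices\<close>

type_synonym edge_list = "(nat \<times> nat) list"

definition edge_list_graph :: "nat \<Rightarrow> edge_list \<Rightarrow> nat graph" where
  "edge_list_graph n es = ({..<n}, (\<lambda>(a, b). {a, b}) ` set es)"

definition edge_list_on :: "nat \<Rightarrow> edge_list \<Rightarrow> bool" where
  "edge_list_on n es \<longleftrightarrow> list_all (\<lambda>(a, b). a < b \<and> b < n) es"

lemma verts_edge_list_graph [simp]: "verts (edge_list_graph n es) = {..<n}"
  by (simp add: edge_list_graph_def)

lemma simple_edge_list_graph: "edge_list_on n es \<Longrightarrow> simple_graph (edge_list_graph n es)"
  by (fastforce simp: edge_list_on_def list_all_iff simple_graph_def edge_list_graph_def)

text \<open>The list \<open>f\<close> is the isomorphism in one-line notation. It may be a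
  permutation or may lead to a concrete graph whose labels are not an initial segment.\<close>

lemma edge_list_graph_isoI:
  assumes es: "edge_list_on n es" and f: "distinct f" "length f = n"
    and K: "verts K = set f" "edges K = (\<lambda>(a, b). {f ! a, f ! b}) ` set es"
  shows "simple_graph K" "graph_iso (edge_list_graph n es) K"
proof -
  show "simple_graph K"
    unfolding simple_graph_def K
  proof (intro conjI ballI)
    fix e assume "e \<in> (\<lambda>(a, b). {f ! a, f ! b}) ` set es"
    then obtain a b where ab: "(a, b) \<in> set es" "e = {f ! a, f ! b}" by auto
    then have "a < b" "b < n" using es by (auto simp: edge_list_on_def list_all_iff)
    with ab f show "e \<subseteq> set f" "card e = 2" by (auto simp: card_2_iff nth_eq_iff_index_eq)
  qed simp
  have "bij_betw ((!) f) {..<n} (set f)"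
    using f by (intro bij_betw_nth) auto
  moreover have "(\<lambda>(a, b). {f ! a, f ! b}) ` set es = (`) ((!) f) ` (\<lambda>(a, b). {a, b}) ` set es"
    by (auto simp: image_image case_prod_beta)
  ultimately show "graph_iso (edge_list_graph n es) K"
    using simple_edge_list_graph[OF es] K
    by (intro graph_iso_imageI[of "(!) f"]) (auto simp: edge_list_graph_def simple_graph_def)
qed

text \<open>On at most five vertices the sort key orders the edges lexicographically, as in the tables
    below.\<close>

definition relabel :: "nat list \<Rightarrow> edge_list \<Rightarrow> edge_list" where
  "relabel p es =
     sort_key (\<lambda>(a, b). 5 * a + b) (map (\<lambda>(a, b). (min (p ! a) (p ! b), max (p ! a) (p ! b))) es)"

lemma graph_iso_relabel:
  assumes "edge_list_on n es" "distinct p" "length p = n" "list_all (\<lambda>i. i < n) p"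
  shows "graph_iso (edge_list_graph n es) (edge_list_graph n (relabel p es))"
proof (rule edge_list_graph_isoI(2)[OF assms(1-3)])
  have "set p = {..<n}"
    using assms(2-4) by (intro card_subset_eq) (auto simp: list_all_iff distinct_card)
  then show "verts (edge_list_graph n (relabel p es)) = set p" by simp
  have "(\<lambda>(a, b). {a, b}) ((\<lambda>(a, b). (min (p ! a) (p ! b), max (p ! a) (p ! b))) d)
      = (\<lambda>(a, b). {p ! a, p ! b}) d" for d
    by (auto simp: min_def max_def split: prod.split)
  then show "edges (edge_list_graph n (relabel p es)) = (\<lambda>(a, b). {p ! a, p ! b}) ` set es"
    by (simp add: edge_list_graph_def relabel_def image_image)
qed

section \<open>Evaluating the invariants on edge lists\<close>

definition stable_list :: "edge_list \<Rightarrow> nat list \<Rightarrow> bool" where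
  "stable_list es xs \<longleftrightarrow> list_all (\<lambda>(a, b). \<not> (a \<in> set xs \<and> b \<in> set xs)) es"

definition count_stable :: "edge_list \<Rightarrow> nat list \<Rightarrow> nat \<Rightarrow> nat" where
  "count_stable es xs k = length (filter (\<lambda>ys. length ys = k \<and> stable_list es ys) (subseqs xs))"

definition count_deck :: "edge_list \<Rightarrow> nat list \<Rightarrow> nat \<Rightarrow> nat" where
  "count_deck es xs j = length (filter (\<lambda>ys. length ys = 4 \<and> count_stable es ys 2
      = j) (subseqs xs))"

text \<open>The subsequences of a list without repetitions run through the subsets of its elements
  exactly once each.\<close>

lemma card_subsets_subseqs:
  assumes "distinct xs"
  shows "card {J. J \<subseteq> set xs \<and> P J} = length (filter (\<lambda>ys. P (set ys)) (subseqs xs))"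
proof -
  have "{J. J \<subseteq> set xs \<and> P J} = set (filter P (map set (subseqs xs)))"
    using subseqs_powset[of xs] by auto
  moreover have "distinct (filter P (map set (subseqs xs)))"
    using assms by (intro distinct_filter distinct_set_subseqs)
  ultimately show ?thesis by (simp only: distinct_card) (simp add: filter_map o_def)
qed

lemma stable_count_edge_list_graph:
  assumes "distinct xs"
  shows "stable_count (edge_list_graph n es) (set xs) k = count_stable es xs k"
proof -
  have "stable_set (edge_list_graph n es) (set ys) \<longleftrightarrow> stable_list es ys" for ys
    by (auto simp: stable_set_def stable_list_def edge_list_graph_def list_all_iff)
  moreover have "card (set ys) = length ys" if "ys \<in> set (subseqs xs)" for ys
    using subseqs_distinctD[OF that assms] by (rule distinct_card)
  ultimately show ?thesis
    unfolding stable_count_def count_stable_def card_subsets_subseqs[OF assms]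
    by (auto intro!: arg_cong[where f = length] filter_cong)
qed

lemma deck_count_edge_list_graph:
  assumes "distinct xs"
  shows "deck_count (edge_list_graph n es) (set xs) j = count_deck es xs j"
  unfolding deck_count_def count_deck_def card_subsets_subseqs[OF assms]
  using subseqs_distinctD[OF _ assms]
  by (auto simp: distinct_card stable_count_edge_list_graph intro!: arg_cong[where f
      = length] filter_cong)

text \<open>The given isomorphism is extended by sending \<open>v\<close> to the new label
  \<open>n\<close>; \<open>xs\<close> lists the images of the neighbors of \<open>v\<close>.\<close>

lemma graph_iso_add_vertex:
  assumes K: "simple_graph K" and v: "v \<in> verts K"
    and es: "edge_list_on n es"
    and iso: "graph_iso (induced_subgraph K (verts K - {v})) (edge_list_graph n es)"
  shows "\<exists>xs\<in>set (subseqs [0..<n]). graph_iso K (edge_list_graph (Suc n) (es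
      @ map (\<lambda>i. (i, n)) xs))"
proof -
  let ?W = "verts K - {v}"
  obtain f where f: "bij_betw f ?W {..<n}"
    and e: "\<forall>u\<in>?W. \<forall>w\<in>?W. {u, w} \<in> edges (induced_subgraph K ?W)
      \<longleftrightarrow> {f u, f w} \<in> edges (edge_list_graph n es)"
    using iso by (auto simp: graph_iso_def)
  have inj: "inj_on f ?W" and im: "f ` ?W = {..<n}" using f by (auto simp: bij_betw_def)
  have "f ` {u \<in> ?W. {u, v} \<in> edges K} \<in> Pow (set [0..<n])" using im by auto
  then obtain xs where xs: "xs \<in> set (subseqs [0..<n])" "set xs = f ` {u \<in> ?W. {u, v} \<in> edges K}"
    unfolding subseqs_powset[symmetric] by (auto simp del: set_upt)
  let ?H = "edge_list_graph (Suc n) (es @ map (\<lambda>i. (i, n)) xs)"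
  have es_lt: "a < b" "b < n" if "(a, b) \<in> set es" for a b
    using es that by (auto simp: edge_list_on_def list_all_iff)
  have xs_lt: "i < n" if "i \<in> set xs" for i using that xs(2) im by auto
  have edges_H: "edges ?H = edges (edge_list_graph n es) \<union> (\<lambda>i. {i, n}) ` set xs"
    by (auto simp: edge_list_graph_def image_Un image_image)
  have old: "{a, b} \<in> edges ?H \<longleftrightarrow> {a, b} \<in> edges (edge_list_graph n es)" if "a < n" "b < n" for a b
    using that unfolding edges_H by (auto simp: doubleton_eq_iff)
  have new: "{a, n} \<in> edges ?H \<longleftrightarrow> a \<in> set xs" if "a < n" for a
  proof -
    have "{a, n} \<notin> edges (edge_list_graph n es)"
      using es_lt by (fastforce simp: edge_list_graph_def doubleton_eq_iff)
    then show ?thesis using that unfolding edges_H by (auto simp: doubleton_eq_iff)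
  qed
  have loop: "{n} \<notin> edges ?H"
    using es_lt xs_lt unfolding edges_H by (fastforce simp: edge_list_graph_def)
  let ?g = "f(v := n)"
  have g: "bij_betw ?g (verts K) {..<Suc n}"
  proof -
    have "bij_betw ?g ?W {..<n}"
      using f by (subst bij_betw_cong[of _ _ f]) auto
    then have "bij_betw ?g (?W \<union> {v}) ({..<n} \<union> {?g v})"
      by (intro notIn_Un_bij_betw) auto
    then show ?thesis using v by (simp add: insert_absorb lessThan_Suc)
  qed
  have fn: "f u < n" if "u \<in> ?W" for u using im that by auto
  have nbr: "{u, v} \<in> edges K \<longleftrightarrow> f u \<in> set xs" if "u \<in> ?W" for u
    using that inj unfolding xs(2) by (auto dest: inj_onD)
  have "{u, w} \<in> edges K \<longleftrightarrow> {?g u, ?g w} \<in> edges ?H" if "u \<in> verts K" "w \<in> verts K" for u w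
  proof -
    consider "u = v" "w = v" | "u = v" "w \<in> ?W" | "u \<in> ?W" "w = v" | "u \<in> ?W" "w \<in> ?W"
      using \<open>u \<in> verts K\<close> \<open>w \<in> verts K\<close> by blast
    then show ?thesis
    proof cases
      case 1
      have "{v} \<notin> edges K" using K by (auto simp: simple_graph_def)
      with 1 loop show ?thesis by simp
    next
      case 2
      moreover have "{v, w} = {w, v}" "{n, f w} = {f w, n}" by auto
      ultimately show ?thesis using new[OF fn] nbr by auto
    next
      case 3
      then show ?thesis using new[OF fn] nbr by auto
    next
      case 4
      then have "{u, w} \<in> edges K \<longleftrightarrow> {f u, f w} \<in> edges (edge_list_graph n es)"
        using e by (auto simp: induced_subgraph_def)
      then show ?thesis using 4 old[OF fn fn] by auto
    qed
  qed
  with g have "graph_iso K ?H" unfolding graph_iso_def by auto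
  with xs(1) show ?thesis by blast
qed

section \<open>Representatives of all isomorphism types\<close>

definition determined_reps :: "edge_list list" where
  "determined_reps =
    [[], [(0,1)], [(0,1), (0,2)], [(0,1), (2,3)], [(0,1), (0,2), (0,3)],
     [(0,1), (0,2), (0,3), (0,4)], [(0,1), (0,2), (0,3), (0,4), (1,2), (1,3), (1,4)],
     [(0,1), (0,2), (1,2), (3,4)], [(0,1), (0,2), (0,3), (0,4), (1,2)],
     [(0,1), (0,2), (1,3), (2,4)], [(0,1), (0,2), (3,4)]]"

definition remaining_reps :: "edge_list list" where
  "remaining_reps =
    [[(0,1), (0,2), (1,2)], [(0,1), (0,2), (1,3)], [(0,1), (0,2), (0,3), (1,2)],
     [(0,1), (0,2), (0,3), (1,4)], [(0,1), (0,2), (1,3), (2,3)],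
     [(0,1), (0,2), (0,3), (1,2), (1,3)], [(0,1), (0,2), (0,3), (1,2), (1,4)],
     [(0,1), (0,2), (0,3), (1,2), (3,4)], [(0,1), (0,2), (0,3), (1,4), (2,4)],
     [(0,1), (0,2), (1,3), (2,4), (3,4)], [(0,1), (0,2), (0,3), (0,4), (1,2), (1,3)],
     [(0,1), (0,2), (0,3), (0,4), (1,2), (3,4)], [(0,1), (0,2), (0,3), (1,2), (1,3), (2,3)],
     [(0,1), (0,2), (0,3), (1,2), (1,3), (2,4)], [(0,1), (0,2), (0,3), (1,2), (1,4), (3,4)],
     [(0,1), (0,2), (0,3), (1,4), (2,4), (3,4)], [(0,1), (0,2), (0,3), (0,4), (1,2), (1,3), (2,3)],
     [(0,1), (0,2), (0,3), (0,4), (1,2), (1,3), (2,4)],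
     [(0,1), (0,2), (0,3), (1,2), (1,3), (2,4), (3,4)],
     [(0,1), (0,2), (0,3), (0,4), (1,2), (1,3), (1,4), (2,3)],
     [(0,1), (0,2), (0,3), (0,4), (1,2), (1,3), (2,4), (3,4)],
     [(0,1), (0,2), (0,3), (0,4), (1,2), (1,3), (1,4), (2,3), (2,4)],
     [(0,1), (0,2), (0,3), (0,4), (1,2), (1,3), (1,4), (2,3), (2,4), (3,4)]]"

text \<open>The last clause is meant for \<open>n = 5\<close>; larger arguments only receive a
  default value. Completeness of the lists up to five vertices is established in
  \<open>graph_iso_rep\<close>.\<close>

fun reps :: "nat \<Rightarrow> edge_list list" where
  "reps 0 = [[]]"
| "reps (Suc 0) = [[]]"
| "reps (Suc (Suc 0)) = [[], [(0,1)]]"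
| "reps (Suc (Suc (Suc 0))) = [[], [(0,1)], [(0,1), (0,2)], [(0,1), (0,2), (1,2)]]"
| "reps (Suc (Suc (Suc (Suc 0)))) =
    [[], [(0,1)], [(0,1), (0,2)], [(0,1), (2,3)], [(0,1), (0,2), (0,3)], [(0,1), (0,2), (1,2)],
     [(0,1), (0,2), (1,3)], [(0,1), (0,2), (0,3), (1,2)], [(0,1), (0,2), (1,3), (2,3)],
     [(0,1), (0,2), (0,3), (1,2), (1,3)], [(0,1), (0,2), (0,3), (1,2), (1,3), (2,3)]]"
| "reps n = determined_reps @ remaining_reps"

text \<open>The \<open>j\<close>-th entry of \<open>relabelings n\<close> is a permutation that carries the \<open>j\<close>-th one-vertex
  extension of the representatives on \<open>n\<close> vertices to a representative on \<open>n + 1\<close> vertices.\<close>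

fun relabelings :: "nat \<Rightarrow> nat list list" where
  "relabelings 0 = [[0]]"
| "relabelings (Suc 0) = [[0,1], [0,1]]"
| "relabelings (Suc (Suc 0)) = [[1,2,0], [0,2,1], [2,0,1], [0,1,2], [0,1,2], [0,1,2], [1,0,2],
    [0,1,2]]"
| "relabelings (Suc (Suc (Suc 0))) =
    [[1,2,3,0], [1,2,3,0], [1,3,2,0], [0,2,3,1], [3,1,2,0], [2,0,3,1], [2,3,0,1], [0,1,2,3],
     [1,2,3,0], [0,1,3,2], [0,2,3,1], [0,1,3,2], [2,0,3,1], [1,0,3,2], [0,1,2,3], [0,1,2,3],
     [0,2,3,1], [0,1,3,2], [0,3,1,2], [0,1,2,3], [0,1,2,3], [0,1,2,3], [0,2,1,3], [0,1,2,3],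
     [0,1,2,3], [0,1,2,3], [0,2,1,3], [0,1,2,3], [2,0,1,3], [1,0,2,3], [1,2,0,3], [0,1,2,3]]"
| "relabelings n =
    [[1,2,3,4,0], [1,2,3,4,0], [1,2,4,3,0], [1,2,3,4,0], [1,4,2,3,0], [1,3,2,4,0], [1,3,4,2,0],
     [0,2,3,4,1], [4,1,2,3,0], [3,1,2,4,0], [3,1,4,2,0], [2,0,3,4,1], [3,4,1,2,0], [2,3,0,4,1],
     [2,3,4,0,1], [0,1,2,3,4], [1,2,3,4,0], [1,2,3,4,0], [1,2,4,3,0], [0,1,3,4,2], [1,4,2,3,0],
     [0,2,3,4,1], [0,2,4,3,1], [0,1,3,4,2], [4,1,2,3,0], [2,0,3,4,1], [2,0,4,3,1], [1,0,3,4,2],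
     [3,4,1,2,0], [0,1,2,4,3], [0,1,4,2,3], [0,1,2,3,4], [1,2,3,4,0], [0,2,3,4,1], [0,2,3,4,1],
     [0,1,3,4,2], [0,3,2,4,1], [0,3,1,4,2], [0,2,3,4,1], [0,1,2,4,3], [4,1,2,3,0], [0,1,2,4,3],
     [1,0,3,4,2], [0,1,2,4,3], [1,3,0,4,2], [0,2,1,4,3], [0,1,2,3,4], [0,1,2,3,4], [1,2,3,4,0],
     [1,2,3,4,0], [1,2,4,3,0], [0,1,3,4,2], [3,4,1,2,0], [1,3,2,4,0], [1,3,4,2,0], [0,1,3,4,2],
     [4,3,1,2,0], [3,1,2,4,0], [3,1,4,2,0], [1,0,3,4,2], [3,4,0,1,2], [3,4,0,1,2], [3,4,1,0,2],
     [0,1,2,3,4], [0,2,3,4,1], [0,2,3,4,1], [0,2,4,3,1], [0,1,3,4,2], [0,4,2,3,1], [0,3,1,4,2],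
     [0,3,4,1,2], [0,1,2,3,4], [0,1,2,3,4], [0,1,2,3,4], [0,1,3,2,4], [0,1,2,3,4], [0,3,1,2,4],
     [0,2,1,3,4], [0,2,3,1,4], [0,1,2,3,4], [1,2,3,4,0], [0,1,2,4,3], [0,1,3,4,2], [0,1,2,4,3],
     [0,3,1,4,2], [0,2,1,4,3], [0,1,2,4,3], [0,1,2,4,3], [3,0,1,4,2], [2,0,1,4,3], [1,0,2,4,3],
     [1,0,2,4,3], [1,2,0,4,3], [1,2,0,4,3], [0,1,2,3,4], [0,1,2,3,4], [1,2,3,4,0], [0,2,3,4,1],
     [2,0,4,3,1], [0,1,3,4,2], [0,3,2,4,1], [0,3,1,4,2], [0,1,3,4,2], [0,1,2,4,3], [3,0,4,2,1],
     [1,0,4,3,2], [3,0,4,1,2], [1,0,4,2,3], [0,1,2,3,4], [0,1,2,3,4], [1,0,3,2,4], [0,1,2,3,4],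
     [0,2,3,4,1], [0,1,2,4,3], [0,1,3,4,2], [0,1,2,4,3], [0,3,1,4,2], [0,2,1,4,3], [0,1,2,3,4],
     [0,1,2,3,4], [2,0,1,4,3], [2,0,1,4,3], [0,1,2,3,4], [0,1,2,3,4], [0,2,1,3,4], [0,2,1,3,4],
     [0,1,2,3,4], [0,1,2,3,4], [1,2,3,4,0], [0,2,3,4,1], [2,0,4,3,1], [0,1,3,4,2], [2,4,0,3,1],
     [0,3,1,4,2], [0,1,2,4,3], [0,1,2,4,3], [4,2,3,0,1], [1,0,4,2,3], [3,0,4,1,2], [1,0,4,2,3],
     [3,4,0,1,2], [1,4,0,2,3], [4,1,2,0,3], [0,1,2,3,4], [0,1,3,4,2], [0,1,2,4,3], [0,1,4,2,3],
     [0,1,2,3,4], [0,1,2,3,4], [0,1,2,3,4], [0,1,3,2,4], [0,1,2,3,4], [1,0,2,3,4], [1,0,2,3,4],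
     [1,0,3,2,4], [1,0,2,3,4], [0,1,2,3,4], [0,1,2,3,4], [0,1,3,2,4], [0,1,2,3,4], [0,1,2,3,4],
     [0,1,2,3,4], [0,1,3,2,4], [0,1,2,3,4], [0,3,1,2,4], [0,2,1,3,4], [0,2,3,1,4], [0,1,2,3,4],
     [3,0,1,2,4], [2,0,1,3,4], [2,0,3,1,4], [1,0,2,3,4], [2,3,0,1,4], [1,2,0,3,4], [1,2,3,0,4],
     [0,1,2,3,4]]"

text \<open>\<open>list_all2\<close> forces one permutation for every pair of a representative and a
  neighborhood, so no extension is skipped. Membership compares lists literally, which is why
  \<open>relabel\<close> sorts the edges.\<close>

definition augmentations_covered :: "nat \<Rightarrow> bool" where
  "augmentations_covered n \<longleftrightarrow> list_all2
     (\<lambda>(es, xs) p. distinct p \<and> length p = Suc n \<and> list_all (\<lambda>i. i < Suc n) p \<and>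
        relabel p (es @ map (\<lambda>i. (i, n)) xs) \<in> set (reps (Suc n)))
     (List.product (reps n) (subseqs [0..<n])) (relabelings n)"

lemma augmentations_covered_less_5: "list_all augmentations_covered [0..<5]"
  by code_simp

lemma edge_list_on_reps:
  assumes "es \<in> set (reps n)" "n \<le> 5"
  shows "edge_list_on n es"
proof -
  have "list_all (\<lambda>n. list_all (edge_list_on n) (reps n)) [0..<6]"
    by code_simp
  moreover have "n \<in> set [0..<6]" using assms(2) by simp
  ultimately show ?thesis using assms(1) unfolding list_all_iff by blast
qed

text \<open>Induction by deleting a vertex: the smaller graph has a representative, the deleted
  vertex extends it by some neighborhood, and the checked table carries this extension to a
  representative.\<close>

lemma graph_iso_rep:
  assumes "simple_graph K" "card (verts K) = n" "n \<le> 5"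
  shows "\<exists>es\<in>set (reps n). graph_iso K (edge_list_graph n es)"
  using assms
proof (induction n arbitrary: K)
  case 0
  then have "verts K = {}" by (simp add: simple_graph_def)
  then show ?case by (auto simp: graph_iso_def bij_betw_def)
next
  case (Suc n)
  from Suc.prems(2) obtain v where v: "v \<in> verts K" by fastforce
  let ?K' = "induced_subgraph K (verts K - {v})"
  have "simple_graph ?K'" using Suc.prems by (intro simple_induced_subgraph) auto
  moreover have "card (verts ?K') = n" using Suc.prems v by (simp add: simple_graph_def)
  ultimately obtain es where es: "es \<in> set (reps n)" "graph_iso ?K' (edge_list_graph n es)"
    using Suc.IH[of ?K'] Suc.prems(3) by auto
  have on: "edge_list_on n es" using edge_list_on_reps[OF es(1)] Suc.prems(3) by simp
  obtain xs where xs: "xs \<in> set (subseqs [0..<n])"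
    "graph_iso K (edge_list_graph (Suc n) (es @ map (\<lambda>i. (i, n)) xs))"
    using graph_iso_add_vertex[OF Suc.prems(1) v on es(2)] by blast
  have "n \<in> set [0..<5]" using Suc.prems(3) by simp
  then have "augmentations_covered n"
    using augmentations_covered_less_5 unfolding list_all_iff by blast
  moreover have "(es, xs) \<in> set (List.product (reps n) (subseqs [0..<n]))"
    using es(1) xs(1) by simp
  then obtain j where "j < length (List.product (reps n) (subseqs [0..<n]))"
    "List.product (reps n) (subseqs [0..<n]) ! j = (es, xs)"
    unfolding in_set_conv_nth by blast
  ultimately obtain p where p: "distinct p" "length p = Suc n" "list_all (\<lambda>i. i < Suc n) p"
    "relabel p (es @ map (\<lambda>i. (i, n)) xs) \<in> set (reps (Suc n))"
    unfolding augmentations_covered_def by (auto dest: list_all2_nthD)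
  have "set xs \<in> set ` set (subseqs [0..<n])" using xs(1) by (rule imageI)
  then have "set xs \<subseteq> {..<n}" unfolding subseqs_powset by auto
  then have "edge_list_on (Suc n) (es @ map (\<lambda>i. (i, n)) xs)"
    using on by (fastforce simp: edge_list_on_def list_all_iff)
  from graph_iso_relabel[OF this p(1-3)] xs(2) p(4) show ?case
    using graph_iso_trans by blast
qed

section \<open>Forests on four and five vertices\<close>

text \<open>Every representative that is not a forest contains one of these cycles.\<close>

definition small_cycles :: "nat list list" where
  "small_cycles = [[0,1,2], [0,1,3,2], [0,1,4,2], [0,1,3,4,2]]"

definition has_small_cycle :: "edge_list \<Rightarrow> bool" where
  "has_small_cycle es \<longleftrightarrow> list_ex (\<lambda>vs. list_all (\<lambda>i.
     (vs ! i, vs ! (Suc i mod length vs)) \<in> set es \<or> (vs ! (Suc i mod length vs), vs ! i) \<in> set es)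
     [0..<length vs]) small_cycles"

lemma has_small_cycleD:
  assumes "has_small_cycle es"
  shows "\<exists>vs. is_cycle (edge_list_graph n es) vs"
proof -
  obtain vs where vs: "vs \<in> set small_cycles"
    and e: "\<And>i. i < length vs \<Longrightarrow>
      (vs ! i, vs ! (Suc i mod length vs)) \<in> set es \<or> (vs ! (Suc i mod length vs), vs ! i) \<in> set es"
    using assms unfolding has_small_cycle_def list_ex_iff list_all_iff by auto
  have "3 \<le> length vs" "distinct vs" using vs by (auto simp: small_cycles_def)
  moreover have "{vs ! i, vs ! (Suc i mod length vs)} \<in> edges (edge_list_graph n es)"
    if "i < length vs" for i
    using e[OF that] by (force simp: edge_list_graph_def insert_commute)
  ultimately show ?thesis unfolding is_cycle_def by blast
qed

definition stable_pair :: "('a graph) \<Rightarrow> 'a set \<Rightarrow> nat \<times> nat" where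
  "stable_pair G S = (stable_count G S 2, stable_count G S 3)"

lemma stable_pair_iso:
  "simple_graph G \<Longrightarrow> simple_graph H \<Longrightarrow> graph_iso G H \<Longrightarrow>
    stable_pair G (verts G) = stable_pair H (verts H)"
  by (simp add: stable_pair_def graph_iso_counts)

lemma stable_pair_edge_list_graph:
  "stable_pair (edge_list_graph n es) {..<n}
      = (count_stable es [0..<n] 2, count_stable es [0..<n] 3)"
  using stable_count_edge_list_graph[of "[0..<n]"]
  by (simp add: stable_pair_def atLeast0LessThan)

text \<open>A representative with a listed cycle is no forest, so all forests pass the filter, and
  distinct pairs on the filtered list separate them.\<close>

lemma distinct_forest_pairs:
  "list_all (\<lambda>n. distinct (map (\<lambda>es. (count_stable es [0..<n] 2, count_stable es [0..<n] 3))
     (filter (\<lambda>es. \<not> has_small_cycle es) (reps n)))) [4, 5]"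
  by code_simp

text \<open>The representative of an acyclic graph is acyclic and hence survives the filter; there
  the pair determines the representative, so both graphs share it.\<close>

lemma forest_iso_of_stable_pair:
  assumes G: "simple_graph G" "\<nexists>vs. is_cycle G vs" and H: "simple_graph H" "\<nexists>vs. is_cycle H vs"
    and n: "card (verts G) = n" "card (verts H) = n" "n \<in> {4, 5}"
    and pair: "stable_pair G (verts G) = stable_pair H (verts H)"
  shows "graph_iso G H"
proof -
  let ?pair = "\<lambda>es. (count_stable es [0..<n] 2, count_stable es [0..<n] 3)"
  let ?F = "set (filter (\<lambda>es. \<not> has_small_cycle es) (reps n))"
  have inj: "inj_on ?pair ?F"
    using distinct_forest_pairs n(3) by (auto simp: distinct_map)
  have rep: "\<exists>es\<in>?F. graph_iso K (edge_list_graph n es) \<and> ?pair es = stable_pair K (verts K)"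
    if K: "simple_graph K" "\<nexists>vs. is_cycle K vs" "card (verts K) = n" for K :: "'c graph"
  proof -
    from n(3) have n5: "n \<le> 5" by auto
    obtain es where es: "es \<in> set (reps n)" "graph_iso K (edge_list_graph n es)"
      using graph_iso_rep[OF K(1,3) n5] by blast
    have simple: "simple_graph (edge_list_graph n es)"
      using edge_list_on_reps[OF es(1) n5] by (rule simple_edge_list_graph)
    have "\<not> has_small_cycle es"
    proof
      assume "has_small_cycle es"
      then obtain vs where "is_cycle (edge_list_graph n es) vs"
        using has_small_cycleD by blast
      from is_cycle_iso[OF simple graph_iso_sym[OF es(2)] this] K(2) show False by blast
    qed
    moreover have "?pair es = stable_pair K (verts K)"
      using stable_pair_iso[OF K(1) simple es(2)] by (simp add: stable_pair_edge_list_graph)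
    ultimately show ?thesis using es by auto
  qed
  obtain es where es: "es \<in> ?F" "graph_iso G (edge_list_graph n es)"
      "?pair es = stable_pair G (verts G)"
    using rep[OF G n(1)] by blast
  obtain fs where fs: "fs \<in> ?F" "graph_iso H (edge_list_graph n fs)"
      "?pair fs = stable_pair H (verts H)"
    using rep[OF H n(2)] by blast
  have "es = fs" using inj_onD[OF inj _ es(1) fs(1)] es(3) fs(3) pair by simp
  with es fs show ?thesis using graph_iso_sym graph_iso_trans by blast
qed

section \<open>Invariants of the graphs on five vertices\<close>

abbreviation graph5 :: "edge_list \<Rightarrow> nat graph" where
  "graph5 \<equiv> edge_list_graph 5"

text \<open>The deck count for \<open>j\<close> sits at position \<open>j + 2\<close>. These six
  numbers suffice both to tell the remaining representatives apart and to evaluate the linear system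
  on them.\<close>

definition signature5 :: "edge_list \<Rightarrow> nat list" where
  "signature5 es = map (count_stable es [0..<5]) [2,3] @ map (count_deck es [0..<5]) [0,1,2,3]"

lemma determined_pairs:
  "map (\<lambda>es. (count_stable es [0..<5] 2, count_stable es [0..<5] 3)) determined_reps =
     [(10,10), (9,7), (8,5), (8,4), (7,4), (6,4), (3,1), (6,0), (5,2), (6,1), (7,2)]"
  by code_simp

lemma remaining_signatures:
  "map signature5 remaining_reps =
     [[7,3,0,0,0,2], [7,3,0,0,0,1], [6,2,0,0,1,1], [6,2,0,0,0,3], [6,2,0,0,1,0], [5,1,0,1,0,2],
      [5,1,0,0,2,1], [5,0,0,0,1,3], [5,1,0,0,1,3], [5,0,0,0,0,5], [4,1,0,1,2,1], [4,0,0,0,4,0],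
      [4,0,1,0,0,4], [4,0,0,1,1,3], [4,0,0,0,3,2], [4,1,0,0,3,2], [3,0,1,0,3,1], [3,0,0,2,2,1],
      [3,0,0,1,4,0], [2,0,1,2,2,0], [2,0,0,4,1,0], [1,0,2,3,0,0], [0,0,5,0,0,0]]"
  by code_simp

lemma reps_5: "set (reps 5) = set determined_reps \<union> set remaining_reps"
proof -
  have "5 = Suc (Suc (Suc (Suc (Suc 0))))" by simp
  then show ?thesis by (simp only: reps.simps set_append)
qed

lemma simple_graph5: "es \<in> set determined_reps \<union> set remaining_reps \<Longrightarrow> simple_graph (graph5 es)"
  using edge_list_on_reps[of es 5] by (simp add: reps_5 simple_edge_list_graph)

lemma graph5_rep:
  assumes "simple_graph K" "card (verts K) = 5"
  shows "\<exists>es\<in>set determined_reps \<union> set remaining_reps. graph_iso K (graph5 es)"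
  using graph_iso_rep[OF assms] by (simp add: reps_5)

lemma stable_pair_graph5:
  "stable_pair (graph5 es) {..<5} = (count_stable es [0..<5] 2, count_stable es [0..<5] 3)"
  by (rule stable_pair_edge_list_graph)

lemma signature5_eq:
  "signature5 es = map (stable_count (graph5 es) {..<5}) [2,3]
      @ map (deck_count (graph5 es) {..<5}) [0,1,2,3]"
  using stable_count_edge_list_graph[of "[0..<5]"] deck_count_edge_list_graph[of "[0..<5]"]
  by (simp add: signature5_def atLeast0LessThan)

lemma inj_on_determined_pairs: "inj_on (\<lambda>es. stable_pair (graph5 es) {..<5}) (set determined_reps)"
proof -
  have "distinct (map (\<lambda>es. stable_pair (graph5 es) {..<5}) determined_reps)"
    unfolding stable_pair_graph5 determined_pairs by simp
  then show ?thesis by (simp add: distinct_map)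
qed

text \<open>The first two entries of a signature are the pair; none of those in the table of
  remaining signatures occurs among the eleven determined pairs.\<close>

lemma remaining_pair_not_determined:
  assumes "es \<in> set remaining_reps" "ds \<in> set determined_reps"
  shows "stable_pair (graph5 es) {..<5} \<noteq> stable_pair (graph5 ds) {..<5}"
proof -
  have "signature5 es \<in> set (map signature5 remaining_reps)" using assms(1) by simp
  then have "(signature5 es ! 0, signature5 es ! 1) \<notin>
    set (map (\<lambda>es. (count_stable es [0..<5] 2, count_stable es [0..<5] 3)) determined_reps)"
    unfolding remaining_signatures determined_pairs by auto
  moreover have "stable_pair (graph5 es) {..<5} = (signature5 es ! 0, signature5 es ! 1)"
    by (simp add: stable_pair_graph5 signature5_def)
  ultimately show ?thesis using assms(2) by (auto simp: stable_pair_graph5)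
qed

text \<open>Pairs alone do not suffice here: a triangle with two isolated vertices and a four-vertex
  path with one isolated vertex both give \<open>(7,3)\<close>. The deck counts break all such
  ties.\<close>

lemma inj_on_remaining_signatures: "inj_on signature5 (set remaining_reps)"
proof -
  have "distinct (map signature5 remaining_reps)" unfolding remaining_signatures by simp
  then show ?thesis by (simp add: distinct_map)
qed

text \<open>This lets the classes be indexed by representatives without counting a vertex set
  twice.\<close>

lemma remaining_reps_unique:
  assumes "es \<in> set remaining_reps" "fs \<in> set remaining_reps" "graph_iso (graph5 es) (graph5 fs)"
  shows "es = fs"
proof -
  have "signature5 es = signature5 fs"
    using graph_iso_counts[OF simple_graph5 simple_graph5 assms(3)] assms(1,2)
    by (simp add: signature5_eq)
  then show ?thesis using inj_on_remaining_signatures assms(1,2) by (auto dest: inj_onD)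
qed

section \<open>Matching the eleven named graphs with their representatives\<close>

definition determined_list :: "nat graph list" where
  "determined_list =
     [edgeless_graph 5,
      complete_graph 2 \<squnion>\<^sub>g edgeless_graph 3,
      path_graph 3 \<squnion>\<^sub>g edgeless_graph 2,
      (complete_graph 2 \<squnion>\<^sub>g complete_graph 2) \<squnion>\<^sub>g edgeless_graph 1,
      star_graph 3 \<squnion>\<^sub>g edgeless_graph 1,
      star_graph 4,
      complete_tripartite_graph 1 1 3,
      complete_graph 3 \<squnion>\<^sub>g complete_graph 2,
      cricket_graph,
      path_graph 5,
      path_graph 3 \<squnion>\<^sub>g complete_graph 2]"

text \<open>Entry \<open>i\<close> is the isomorphism from the \<open>i\<close>-th determined
  representative to the \<open>i\<close>-th named graph. Labels up to \<open>6\<close> arise because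
  disjoint unions move the vertices to even and odd numbers.\<close>

definition determined_relabelings :: "nat list list" where
  "determined_relabelings =
     [[0,1,2,3,4], [0,2,1,3,5], [2,0,4,1,3], [0,4,2,6,1], [0,2,4,6,1], [0,1,2,3,4], [0,1,2,3,4],
      [0,2,4,1,3], [0,1,2,3,4], [2,1,3,0,4], [2,0,4,1,3]]"

lemma lessThan_numerals:
  "{..<1::nat} = {0}" "{..<2::nat} = {0,1}" "{..<3::nat} = {0,1,2}" "{..<5::nat} = {0,1,2,3,4}"
  "{..3::nat} = {0,1,2,3}" "{..4::nat} = {0,1,2,3,4}"
  by (simp_all add: numeral_eq_Suc lessThan_Suc atMost_Suc insert_commute)

text \<open>The right-hand side ranges over an explicit list, so concrete edge sets can be
  evaluated.\<close>

lemma pairs_conv_product: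
  "{{i, j} | i j. i < n \<and> j < n \<and> P i j} =
     (\<lambda>(i, j). {i, j}) ` set (filter (\<lambda>(i, j). P i j) (List.product [0..<n] [0..<n]))"
  by (auto simp: image_iff) blast

lemma concrete_edges:
  "edges (complete_graph 2) = {{0,1}}"
  "edges (complete_graph 3) = {{0,1}, {0,2}, {1,2}}"
  "edges (path_graph 3) = {{0,1}, {1,2}}"
  "edges (path_graph 5) = {{0,1}, {1,2}, {2,3}, {3,4}}"
  "edges (star_graph 3) = {{0,1}, {0,2}, {0,3}}"
  "edges (star_graph 4) = {{0,1}, {0,2}, {0,3}, {0,4}}"
  "edges (complete_tripartite_graph 1 1 3) =
     {{0,1}, {0,2}, {0,3}, {0,4}, {1,2}, {1,3}, {1,4}}"
proof -
  have upt: "[0..<2] = [0,1::nat]" "[0..<3] = [0,1,2::nat]" "[0..<5] = [0,1,2,3,4::nat]"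
    by code_simp+
  have paths: "{i. Suc i < 3} = {0,1}" "{i. Suc i < 5} = {0,1,2,3}"
    and stars: "{i::nat. 1 \<le> i \<and> i \<le> 3} = {1,2,3}" "{i::nat. 1 \<le> i \<and> i \<le> 4} = {1,2,3,4}"
    by auto
  show "edges (complete_graph 2) = {{0,1}}" "edges (complete_graph 3) = {{0,1}, {0,2}, {1,2}}"
    by (simp_all add: complete_graph_def pairs_conv_product upt insert_commute del: set_filter)
  show "edges (path_graph 3) = {{0,1}, {1,2}}" "edges (path_graph 5) = {{0,1}, {1,2}, {2,3}, {3,4}}"
    unfolding path_graph_def setcompr_eq_image paths by (simp_all add: numeral_2_eq_2[symmetric])
  show "edges (star_graph 3) = {{0,1}, {0,2}, {0,3}}"
    "edges (star_graph 4) = {{0,1}, {0,2}, {0,3}, {0,4}}"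
    unfolding star_graph_def setcompr_eq_image stars by simp_all
  show "edges (complete_tripartite_graph 1 1 3) =
     {{0,1}, {0,2}, {0,3}, {0,4}, {1,2}, {1,3}, {1,4}}"
    by (simp add: complete_tripartite_graph_def Let_def pairs_conv_product upt insert_commute
        del: set_filter)
qed

lemma determined_list_iso:
  assumes "i < 11"
  shows "simple_graph (determined_list ! i)
      \<and> graph_iso (graph5 (determined_reps ! i)) (determined_list ! i)"
proof -
  have "distinct (determined_relabelings ! i) \<and> length (determined_relabelings ! i) = 5 \<and>
    edge_list_on 5 (determined_reps ! i) \<and>
    verts (determined_list ! i) = set (determined_relabelings ! i) \<and>
    edges (determined_list ! i) = (\<lambda>(a, b). {determined_relabelings ! i ! a,
        determined_relabelings ! i ! b}) ` set (determined_reps ! i)"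
  proof -
    have "i \<in> {0,1,2,3,4,5,6,7,8,9,10}" using assms unfolding insert_iff empty_iff by presburger
    then show ?thesis
      by (elim insertE emptyE; hypsubst)
        (simp_all add: determined_list_def determined_relabelings_def determined_reps_def
            edge_list_on_def
        disjoint_union_def concrete_edges concrete_edges[unfolded One_nat_def]
            edgeless_graph_def cricket_graph_def
        complete_graph_def[THEN arg_cong[where f = verts]] path_graph_def[THEN arg_cong[where f
            = verts]]
        star_graph_def[THEN arg_cong[where f = verts]]
        complete_tripartite_graph_def[THEN arg_cong[where f
            = verts]] Let_def lessThan_numerals lessThan_numerals[unfolded One_nat_def]
        insert_commute)
  qed
  then show ?thesis
    using edge_list_graph_isoI[of 5 "determined_reps ! i" "determined_relabelings ! i"
        "determined_list ! i"]
    by simp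
qed

lemma determined_graphs_eq: "determined_graphs = set determined_list"
  by (simp add: determined_graphs_def determined_list_def)

lemma determined_graph_rep:
  assumes "H \<in> determined_graphs"
  shows "simple_graph H" "\<exists>ds\<in>set determined_reps. graph_iso (graph5 ds) H"
proof -
  have "length determined_list = 11" "length determined_reps = 11"
    by (simp_all add: determined_list_def determined_reps_def)
  then obtain i where "i < 11" "H = determined_list ! i" "determined_reps ! i \<in> set determined_reps"
    using assms by (auto simp: determined_graphs_eq in_set_conv_nth)
  then show "simple_graph H" "\<exists>ds\<in>set determined_reps. graph_iso (graph5 ds) H"
    using determined_list_iso by auto
qed

lemma determined_rep_graph:
  assumes "ds \<in> set determined_reps"
  shows "\<exists>H\<in>determined_graphs. graph_iso (graph5 ds) H"
proof -
  have "length determined_list = 11" "length determined_reps = 11"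
    by (simp_all add: determined_list_def determined_reps_def)
  then obtain i where "i < 11" "ds = determined_reps ! i" "determined_list ! i \<in> determined_graphs"
    using assms by (auto simp: determined_graphs_eq in_set_conv_nth)
  then show ?thesis using determined_list_iso by auto
qed

section \<open>Counting induced subgraphs\<close>

text \<open>Once isomorphism to \<open>H\<close> is expressed by the sequence alone, the count has
  the form handled by \<open>kromatic_determines_stable_counts\<close>.\<close>

lemma num_induced_eq_sum:
  assumes "finite (verts G)"
    and "\<And>U. U \<subseteq> verts G \<Longrightarrow> graph_iso (induced_subgraph G U) H \<longleftrightarrow> P (stable_count G U)"
  shows "real (num_induced H G) = (\<Sum>U\<in>Pow (verts G). of_bool (P (stable_count G U)))"
proof -
  have "{U. U \<subseteq> verts G \<and> graph_iso (induced_subgraph G U) H} = {U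
      \<in> Pow (verts G). P (stable_count G U)}"
    using assms(2) by auto
  then show ?thesis
    using assms(1) by (simp add: num_induced_def of_bool_def sum.If_cases Int_def)
qed

lemma graph_iso_induced_stable_count:
  assumes "simple_graph G" "U \<subseteq> verts G" "simple_graph H" "graph_iso (induced_subgraph G U) H"
  shows "stable_count G U = stable_count H (verts H)"
  using graph_iso_counts(1)[OF simple_induced_subgraph[OF assms(1,2)] assms(3,4)]
  by (simp add: stable_count_induced_subgraph)

lemma card_of_stable_count_eq:
  assumes "simple_graph G" "U \<subseteq> verts G" "simple_graph H"
      "stable_count G U = stable_count H (verts H)"
  shows "card U = card (verts H)"
proof -
  have "finite U" "finite (verts H)" using assms
      by (auto simp: simple_graph_def intro: finite_subset)
  then show ?thesis
    using stable_count_1[OF assms(1), of U] stable_count_1[OF assms(3), of "verts H"] assms(4)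
        by simp
qed

lemma stable_pair_rep:
  assumes "simple_graph K" "es \<in> set determined_reps \<union> set remaining_reps" "graph_iso K (graph5 es)"
  shows "stable_pair K (verts K) = stable_pair (graph5 es) {..<5}"
  using stable_pair_iso[OF assms(1) simple_graph5[OF assms(2)] assms(3)] by simp

text \<open>\<open>K\<close> has some representative with the same pair. It cannot be a remaining
  one, and among the determined ones the pair leaves only \<open>ds\<close>.\<close>

lemma determined_iso_of_stable_pair:
  assumes K: "simple_graph K" "card (verts K) = 5" and ds: "ds \<in> set determined_reps"
    and pair: "stable_pair K (verts K) = stable_pair (graph5 ds) {..<5}"
  shows "graph_iso K (graph5 ds)"
proof -
  obtain es where es: "es \<in> set determined_reps \<union> set remaining_reps" "graph_iso K (graph5 es)"
    using graph5_rep[OF K] by blast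
  have eq: "stable_pair (graph5 es) {..<5} = stable_pair (graph5 ds) {..<5}"
    using stable_pair_rep[OF K(1) es] pair by simp
  then have "es \<in> set determined_reps"
    using es(1) remaining_pair_not_determined[OF _ ds] by auto
  then have "es = ds" using inj_onD[OF inj_on_determined_pairs eq _ ds] by simp
  with es show ?thesis by simp
qed

text \<open>An induced subgraph is isomorphic to \<open>H\<close> exactly if its sequence is that of
  \<open>H\<close>: coordinate \<open>1\<close> forces five vertices, and coordinates
  \<open>2\<close> and \<open>3\<close> then force the isomorphism type.\<close>

lemma determined_num_induced:
  fixes G :: "'a graph" and G' :: "'b graph"
  assumes H: "H \<in> determined_graphs" and G: "simple_graph G" and G': "simple_graph G'"
    and eq: "kromatic G = kromatic G'"
  shows "num_induced H G = num_induced H G'"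
proof -
  obtain ds where ds: "ds \<in> set determined_reps" "graph_iso (graph5 ds) H"
    using determined_graph_rep(2)[OF H] by blast
  have H': "simple_graph H" using determined_graph_rep(1)[OF H] .
  have cardH: "card (verts H) = 5" using graph_iso_card[OF ds(2)] by simp
  have pair: "stable_pair H (verts H) = stable_pair (graph5 ds) {..<5}"
    using stable_pair_iso[OF simple_graph5 H' ds(2)] ds(1) by simp
  have count: "real (num_induced H K) =
      (\<Sum>U\<in>Pow (verts K). of_bool (stable_count K U = stable_count H (verts H)))"
    if K: "simple_graph K" for K :: "'c graph"
  proof (rule num_induced_eq_sum)
    show "finite (verts K)" using K by (simp add: simple_graph_def)
    fix U assume U: "U \<subseteq> verts K"
    show "graph_iso (induced_subgraph K U) H \<longleftrightarrow> stable_count K U = stable_count H (verts H)"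
    proof
      show "graph_iso (induced_subgraph K U) H" if eq: "stable_count K U = stable_count H (verts H)"
      proof -
        have "graph_iso (induced_subgraph K U) (graph5 ds)"
        proof (rule determined_iso_of_stable_pair[OF simple_induced_subgraph[OF K U] _ ds(1)])
          show "card (verts (induced_subgraph K U)) = 5"
            using card_of_stable_count_eq[OF K U H' eq] cardH by simp
          show "stable_pair (induced_subgraph K U) (verts (induced_subgraph K U))
              = stable_pair (graph5 ds) {..<5}"
            using eq pair by (simp add: stable_pair_def stable_count_induced_subgraph)
        qed
        then show ?thesis using ds(2) graph_iso_trans by blast
      qed
    qed (rule graph_iso_induced_stable_count[OF K U H'])
  qed
  have "real (num_induced H G) = real (num_induced H G')"
    unfolding count[OF G] count[OF G']
    by (rule kromatic_determines_stable_counts[OF G G' eq, of "\<lambda>p. of_bool (p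
        = stable_count H (verts H))"])
  then show ?thesis by simp
qed

text \<open>Induced subgraphs of a tree are acyclic. So both counts vanish if \<open>H\<close> has a
  cycle, and otherwise only forests have to be told apart, which their sequences do.\<close>

lemma tree_num_induced:
  fixes H :: "'c graph" and T :: "'a graph" and T' :: "'b graph"
  assumes H: "simple_graph H" "card (verts H) \<in> {4, 5}" and T: "tree T" and T': "tree T'"
    and eq: "kromatic T = kromatic T'"
  shows "num_induced H T = num_induced H T'"
proof (cases "\<exists>vs. is_cycle H vs")
  case True
  have zero: "num_induced H K = 0" if "tree K" for K :: "'d graph"
  proof -
    have "\<not> graph_iso (induced_subgraph K U) H" if "U \<subseteq> verts K" for U
    proof
      assume "graph_iso (induced_subgraph K U) H"
      then obtain ws where "is_cycle (induced_subgraph K U) ws"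
        using True is_cycle_iso[OF H(1)] graph_iso_sym by blast
      then have "is_cycle K ws" by (rule is_cycle_induced_subgraph)
      then show False using \<open>tree K\<close> by (auto simp: tree_def)
    qed
    then have "{U. U \<subseteq> verts K \<and> graph_iso (induced_subgraph K U) H} = {}" by blast
    then show ?thesis by (simp only: num_induced_def card.empty)
  qed
  show ?thesis using zero[OF T] zero[OF T'] by simp
next
  case False
  have count: "real (num_induced H K) =
      (\<Sum>U\<in>Pow (verts K). of_bool (stable_count K U = stable_count H (verts H)))"
    if "tree K" for K :: "'d graph"
  proof (rule num_induced_eq_sum)
    have K: "simple_graph K" using that by (simp add: tree_def)
    then show "finite (verts K)" by (simp add: simple_graph_def)
    fix U assume U: "U \<subseteq> verts K"
    show "graph_iso (induced_subgraph K U) H \<longleftrightarrow> stable_count K U = stable_count H (verts H)"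
    proof
      assume eq: "stable_count K U = stable_count H (verts H)"
      have "\<nexists>vs. is_cycle (induced_subgraph K U) vs"
        using is_cycle_induced_subgraph[of K U] that unfolding tree_def by blast
      moreover have "stable_pair (induced_subgraph K U) (verts (induced_subgraph K U))
          = stable_pair H (verts H)"
        using eq by (simp add: stable_pair_def stable_count_induced_subgraph)
      moreover have "card (verts (induced_subgraph K U)) = card (verts H)"
        using card_of_stable_count_eq[OF K U H(1) eq] by simp
      ultimately show "graph_iso (induced_subgraph K U) H"
        using forest_iso_of_stable_pair[OF simple_induced_subgraph[OF K U] _ H(1) False _ refl
            H(2)] by simp
    qed (rule graph_iso_induced_stable_count[OF K U H(1)])
  qed
  have simple: "simple_graph T" "simple_graph T'" using T T' by (auto simp: tree_def)
  have "real (num_induced H T) = real (num_induced H T')"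
    unfolding count[OF T] count[OF T']
    by (rule kromatic_determines_stable_counts[OF simple eq, of "\<lambda>p. of_bool (p
        = stable_count H (verts H))"])
  then show ?thesis by simp
qed

section \<open>The linear system for the remaining classes\<close>

definition iso5 :: "(nat graph \<times> nat graph) set" where
  "iso5 = {(H, K). H \<in> graphs5 \<and> K \<in> graphs5 \<and> graph_iso H K}"

definition class5 :: "edge_list \<Rightarrow> nat graph set" where
  "class5 es = iso5 `` {graph5 es}"

lemma equiv_iso5: "equiv graphs5 iso5"
  unfolding equiv_def refl_on_def sym_on_def trans_on_def iso5_def
  using graph_iso_refl graph_iso_sym graph_iso_trans by blast

lemma graph5_in_graphs5: "es \<in> set determined_reps \<union> set remaining_reps \<Longrightarrow> graph5 es \<in> graphs5"
  using simple_graph5 by (simp add: graphs5_def)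

lemma mem_class5:
  "es \<in> set determined_reps \<union> set remaining_reps \<Longrightarrow>
    H \<in> class5 es \<longleftrightarrow> H \<in> graphs5 \<and> graph_iso (graph5 es) H"
  using graph5_in_graphs5 by (auto simp: class5_def iso5_def)

lemma graph_classes5_eq: "graph_classes5 = class5 ` (set determined_reps \<union> set remaining_reps)"
proof
  show "graph_classes5 \<subseteq> class5 ` (set determined_reps \<union> set remaining_reps)"
  proof
    fix C assume "C \<in> graph_classes5"
    then obtain H where H: "H \<in> graphs5" "C = iso5 `` {H}"
      unfolding graph_classes5_def iso5_def[symmetric] by (rule quotientE)
    have "simple_graph H" "card (verts H) = 5" using H(1) by (simp_all add: graphs5_def)
    then obtain es where es: "es \<in> set determined_reps \<union> set remaining_reps"
        "graph_iso H (graph5 es)"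
      using graph5_rep by blast
    then have "(H, graph5 es) \<in> iso5" using H(1) graph5_in_graphs5 by (auto simp: iso5_def)
    then have "C = class5 es" unfolding H(2) class5_def by (rule equiv_class_eq[OF equiv_iso5])
    with es(1) show "C \<in> class5 ` (set determined_reps \<union> set remaining_reps)" by blast
  qed
  show "class5 ` (set determined_reps \<union> set remaining_reps) \<subseteq> graph_classes5"
    unfolding graph_classes5_def iso5_def[symmetric] class5_def
    by (auto intro!: quotientI graph5_in_graphs5)
qed

lemma remaining_not_iso_determined:
  assumes "es \<in> set remaining_reps" "ds \<in> set determined_reps"
  shows "\<not> graph_iso (graph5 es) (graph5 ds)"
  using stable_pair_rep[of "graph5 es" ds] simple_graph5[of es] remaining_pair_not_determined[OF
      assms] assms
  by auto

text \<open>The class of a determined representative contains that representative, which is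
  isomorphic to a named graph. For any other class, an isomorphism to a named graph would identify a
  remaining with a determined representative, against their pairs.\<close>

lemma remaining_classes5_eq: "remaining_classes5 = class5 ` set remaining_reps"
proof -
  have det: "\<exists>H\<in>class5 ds. \<exists>K\<in>determined_graphs. graph_iso H K"
      if ds: "ds \<in> set determined_reps" for ds
    using determined_rep_graph[OF ds] mem_class5[of ds "graph5 ds"] graph5_in_graphs5[of ds] ds
        graph_iso_refl
    by blast
  have rem: "\<not> graph_iso H K"
    if es: "es \<in> set remaining_reps" and H: "H \<in> class5 es" and K: "K \<in> determined_graphs"
        for es H K
  proof
    assume "graph_iso H K"
    moreover have "graph_iso (graph5 es) H" using mem_class5[of es H] es H by simp
    moreover obtain ds where "ds \<in> set determined_reps" "graph_iso (graph5 ds) K"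
      using determined_graph_rep(2)[OF K] by blast
    ultimately show False
      using remaining_not_iso_determined[OF es] graph_iso_trans graph_iso_sym by blast
  qed
  show ?thesis
    unfolding remaining_classes5_def graph_classes5_eq using det rem by blast
qed

text \<open>Hence the number of classes is the length of the list, and sums over classes can be
  reindexed by representatives.\<close>

lemma inj_on_class5: "inj_on class5 (set remaining_reps)"
proof (rule inj_onI)
  fix es fs assume es: "es \<in> set remaining_reps" and fs: "fs \<in> set remaining_reps"
      and eq: "class5 es = class5 fs"
  have "graph5 fs \<in> class5 fs" using mem_class5[of fs "graph5 fs"] graph5_in_graphs5[of fs] fs
      graph_iso_refl by blast
  then have "graph_iso (graph5 es) (graph5 fs)" using mem_class5[of es "graph5 fs"] es eq by simp
  then show "es = fs" by (rule remaining_reps_unique[OF es fs])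
qed

lemma card_remaining_classes5: "card remaining_classes5 = 23"
proof -
  have "distinct remaining_reps" "length remaining_reps = 23" by code_simp+
  then show ?thesis
    by (simp add: remaining_classes5_eq card_image[OF inj_on_class5] distinct_card)
qed

lemma num_induced_class5:
  assumes G: "simple_graph G" and es: "es \<in> set remaining_reps"
  shows "real (num_induced_class (class5 es) G) =
    (\<Sum>U\<in>Pow (verts G). of_bool (graph_iso (induced_subgraph G U) (graph5 es)))"
proof -
  have "(\<exists>H\<in>class5 es. graph_iso K H) \<longleftrightarrow> graph_iso K (graph5 es)" for K :: "'a graph"
    using mem_class5[of es] es graph5_in_graphs5[of es] graph_iso_refl graph_iso_sym
        graph_iso_trans by blast
  then have "{U. U \<subseteq> verts G \<and> (\<exists>H\<in>class5 es. graph_iso (induced_subgraph G U) H)}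
    = {U \<in> Pow (verts G). graph_iso (induced_subgraph G U) (graph5 es)}" by auto
  moreover have "finite (verts G)" using G by (simp add: simple_graph_def)
  ultimately show ?thesis
    by (simp add: num_induced_class_def of_bool_def sum.If_cases Int_def)
qed

section \<open>Coefficients of the system and their independence\<close>

text \<open>The values of \<open>(i\<^sub>2, i\<^sub>3)\<close> on the remaining classes.\<close>

definition remaining_pairs :: "(nat \<times> nat) list" where
  "remaining_pairs = [(7,3), (6,2), (5,1), (5,0), (4,1), (4,0), (3,0), (2,0), (1,0), (0,0)]"

text \<open>Stated for graphs rather than classes, so that the coefficient can also be read off an
  induced subgraph of \<open>G\<close>.\<close>

definition equation_coeff :: "nat \<Rightarrow> 'a graph \<Rightarrow> real" where
  "equation_coeff i H =
     (if i < 10 then of_bool (stable_pair H (verts H) = remaining_pairs ! i)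
      else real (deck_count H (verts H) (i - 10)))"

lemma equation_coeff_iso:
  "simple_graph G \<Longrightarrow> simple_graph H \<Longrightarrow> graph_iso G H \<Longrightarrow> equation_coeff i G = equation_coeff i H"
  by (simp add: equation_coeff_def stable_pair_iso graph_iso_counts(2))

text \<open>By \<open>equation_coeff_iso\<close> the value does not depend on the chosen member of a
  nonempty isomorphism class.\<close>

definition class_coeff :: "nat \<Rightarrow> nat graph set \<Rightarrow> real" where
  "class_coeff i C = equation_coeff i (SOME H. H \<in> C)"

lemma class_coeff_class5:
  assumes "es \<in> set remaining_reps"
  shows "class_coeff i (class5 es) = equation_coeff i (graph5 es)"
proof -
  have es: "es \<in> set determined_reps \<union> set remaining_reps" using assms by simp
  have "graph5 es \<in> class5 es" using mem_class5[OF es] graph5_in_graphs5[OF es] graph_iso_refl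
      by blast
  then have "(SOME H. H \<in> class5 es) \<in> class5 es" by (rule someI)
  then have "simple_graph (SOME H. H \<in> class5 es)" "graph_iso (graph5 es) (SOME H. H \<in> class5 es)"
    using mem_class5[OF es] by (auto simp: graphs5_def)
  then show ?thesis
    unfolding class_coeff_def by (rule equation_coeff_iso[OF simple_graph5[OF es], symmetric])
qed

text \<open>Columns with equal pairs differ only in their deck counts. The differences inside the
  groups \<open>(7,3)\<close>, \<open>(6,2)\<close>, \<open>(5,1)\<close> and \<open>(4,0)\<close>
  make the last four coefficients vanish one after another; each of the ten pairs occurs in some
  column, so the other coefficients vanish as well.\<close>

lemma equation_coeffs_independent:
  assumes "\<forall>C\<in>remaining_classes5. (\<Sum>i<14. c i * class_coeff i C) = 0" and "i < 14"
  shows "c i = 0"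
proof -
  \<comment> \<open>Row \<open>i\<close> with \<open>i \<ge> 10\<close> concerns the deck count for
    \<open>j = i - 10\<close>, found at position \<open>j + 2 = i - 8\<close> of the
    signature.\<close>
  define row :: "nat list \<Rightarrow> nat \<Rightarrow> real" where
    "row s i = (if i < 10 then of_bool ((s ! 0, s ! 1) = remaining_pairs ! i)
        else real (s ! (i - 8)))" for s i
  have row: "equation_coeff i (graph5 es) = row (signature5 es) i" if "i < 14" for i es
  proof (cases "i < 10")
    case False
    then have "i - 10 \<in> {0,1,2,3}" "i - 8 = Suc (Suc (i - 10))" using that by auto
    with False show ?thesis by (auto simp: equation_coeff_def row_def signature5_eq numeral_3_eq_3)
  qed (simp add: equation_coeff_def row_def signature5_eq stable_pair_def)
  have "(\<Sum>i<14. c i * row s i) = 0" if s: "s \<in> set (map signature5 remaining_reps)" for s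
  proof -
    obtain es where es: "es \<in> set remaining_reps" "s = signature5 es"
      using s unfolding set_map by blast
    have "(\<Sum>i<14. c i * row s i) = (\<Sum>i<14. c i * class_coeff i (class5 es))"
      unfolding es(2) by (intro sum.cong refl) (simp add: row class_coeff_class5[OF es(1)])
    then show ?thesis using assms(1) es(1) by (simp add: remaining_classes5_eq)
  qed
  then have eqs: "\<forall>s\<in>set (map signature5 remaining_reps). (\<Sum>i<14. c i * row s i) = 0" by blast
  have sum14: "(\<Sum>i<14. h i) = h 0 + h 1 + h 2 + h 3 + h 4 + h 5 + h 6 + h 7 + h 8 + h 9 + h 10 +
      h 11 + h 12 + h 13"
    for h :: "nat \<Rightarrow> real" by (simp add: eval_nat_numeral)
  note eqs = eqs[unfolded remaining_signatures sum14 row_def remaining_pairs_def, simplified]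
  have "c 0 = 0 \<and> c 1 = 0 \<and> c 2 = 0 \<and> c 3 = 0 \<and> c 4 = 0 \<and> c 5 = 0 \<and> c 6 = 0 \<and> c 7 = 0 \<and> c 8 = 0 \<and>
    c 9 = 0 \<and> c 10 = 0 \<and> c 11 = 0 \<and> c 12 = 0 \<and> c 13 = 0"
    using eqs by auto
  moreover have "i \<in> {0,1,2,3,4,5,6,7,8,9,10,11,12,13}" using assms(2)
      unfolding insert_iff empty_iff by presburger
  ultimately show ?thesis by auto
qed

text \<open>Double counting of pairs \<open>W \<subseteq> U\<close> of sizes four and five: each
  \<open>W\<close> is extended by one of the other vertices. With fewer than four vertices no such
  \<open>W\<close> exists, so the truncated difference is harmless.\<close>

lemma sum_deck_counts:
  assumes G: "simple_graph G"
  shows "(\<Sum>U\<in>Pow (verts G). of_bool (card U = 5) * real (deck_count G U j)) =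
    real (card (verts G) - 4) * (\<Sum>W\<in>Pow (verts G). of_bool (card W = 4 \<and> stable_count G W 2 = j))"
proof -
  let ?V = "verts G"
  have fin: "finite ?V" using G by (simp add: simple_graph_def)
  let ?Q = "\<lambda>W. card W = 4 \<and> stable_count G W 2 = j"
  have "(\<Sum>U\<in>Pow ?V. of_bool (card U = 5) * real (deck_count G U j)) =
    (\<Sum>U\<in>Pow ?V. \<Sum>W\<in>Pow ?V. of_bool (card U = 5 \<and> W \<subseteq> U) * of_bool (?Q W))"
  proof (rule sum.cong[OF refl])
    fix U assume "U \<in> Pow ?V"
    then have "{W. W \<subseteq> U \<and> ?Q W} = {W \<in> Pow ?V. W \<subseteq> U \<and> ?Q W}" by auto
    then have "real (deck_count G U j) = (\<Sum>W\<in>Pow ?V. of_bool (W \<subseteq> U \<and> ?Q W))"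
      using fin by (simp add: deck_count_def of_bool_def sum.If_cases Int_def)
    then show "of_bool (card U = 5) * real (deck_count G U j) =
      (\<Sum>W\<in>Pow ?V. of_bool (card U = 5 \<and> W \<subseteq> U) * of_bool (?Q W))"
      by (simp add: sum_distrib_left of_bool_conj mult.assoc)
  qed
  also have "\<dots> = (\<Sum>W\<in>Pow ?V. \<Sum>U\<in>Pow ?V. of_bool (card U = 5 \<and> W \<subseteq> U) * of_bool (?Q W))"
    by (rule sum.swap)
  also have "\<dots> = (\<Sum>W\<in>Pow ?V. real (card ?V - 4) * of_bool (?Q W))"
  proof (rule sum.cong[OF refl])
    fix W assume "W \<in> Pow ?V"
    then have W: "W \<subseteq> ?V" by simp
    show "(\<Sum>U\<in>Pow ?V. of_bool (card U = 5 \<and> W \<subseteq> U) * of_bool (?Q W)) = real (card ?V - 4)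
        * of_bool (?Q W)"
    proof (cases "?Q W")
      case True
      have finW: "finite W" using W fin by (rule finite_subset)
      have "{U \<in> Pow ?V. card U = 5 \<and> W \<subseteq> U} = (\<lambda>v. insert v W) ` (?V - W)"
      proof
        show "{U \<in> Pow ?V. card U = 5 \<and> W \<subseteq> U} \<subseteq> (\<lambda>v. insert v W) ` (?V - W)"
        proof
          fix U assume U: "U \<in> {U \<in> Pow ?V. card U = 5 \<and> W \<subseteq> U}"
          then have "card (U - W) = 1" using True finW by (simp add: card_Diff_subset)
          then obtain v where "U - W = {v}" by (auto simp: card_1_singleton_iff)
          with U show "U \<in> (\<lambda>v. insert v W) ` (?V - W)" by blast
        qed
        show "(\<lambda>v. insert v W) ` (?V - W) \<subseteq> {U \<in> Pow ?V. card U = 5 \<and> W \<subseteq> U}"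
          using True W finW by auto
      qed
      moreover have "inj_on (\<lambda>v. insert v W) (?V - W)" by (auto intro!: inj_onI)
      ultimately have "card {U \<in> Pow ?V. card U = 5 \<and> W \<subseteq> U} = card ?V - 4"
        using True W finW by (simp add: card_image card_Diff_subset)
      then show ?thesis using True fin by (simp add: of_bool_def sum.If_cases Int_def)
    next
      case False
      then have "of_bool (?Q W) = (0::real)" by (simp only: of_bool_eq)
      then show ?thesis by (simp only: mult_zero_right sum.neutral_const)
    qed
  qed
  finally show ?thesis by (simp add: sum_distrib_left)
qed

text \<open>Membership in a remaining class is thus a condition on the sequence, although the
  individual class is not.\<close>

lemma remaining_iff_stable_pair:
  assumes K: "simple_graph K"
  shows "(\<exists>es\<in>set remaining_reps. graph_iso K (graph5 es)) \<longleftrightarrow>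
    card (verts K) = 5 \<and> stable_pair K (verts K)
        \<notin> (\<lambda>ds. stable_pair (graph5 ds) {..<5}) ` set determined_reps"
    (is "?L \<longleftrightarrow> ?R")
proof
  assume ?L
  then obtain es where es: "es \<in> set remaining_reps" "graph_iso K (graph5 es)" by blast
  then show ?R
    using stable_pair_rep[OF K, of es] remaining_pair_not_determined[OF es(1)] graph_iso_card[OF
        es(2)] by auto
next
  assume R: ?R
  then obtain es where es: "es \<in> set determined_reps \<union> set remaining_reps" "graph_iso K (graph5 es)"
    using graph5_rep[OF K] by blast
  then show ?L using stable_pair_rep[OF K es] R by auto
qed

text \<open>An induced subgraph is isomorphic to at most one remaining representative, so exchanging
  the sums turns a sum over classes into one over vertex sets, each with its own
  coefficient.\<close>

lemma sum_remaining_classes: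
  assumes G: "simple_graph G"
  shows "(\<Sum>C\<in>remaining_classes5. class_coeff i C * real (num_induced_class C G)) =
    (\<Sum>U\<in>Pow (verts G). of_bool (card U = 5 \<and>
        stable_pair G U \<notin> (\<lambda>ds. stable_pair (graph5 ds) {..<5}) ` set determined_reps) *
      equation_coeff i (induced_subgraph G U))"
proof -
  let ?iso = "\<lambda>U es. graph_iso (induced_subgraph G U) (graph5 es)"
  have "(\<Sum>C\<in>remaining_classes5. class_coeff i C * real (num_induced_class C G)) =
    (\<Sum>es\<in>set remaining_reps. equation_coeff i (graph5 es)
        * (\<Sum>U\<in>Pow (verts G). of_bool (?iso U es)))"
    by (simp add: remaining_classes5_eq sum.reindex[OF inj_on_class5] class_coeff_class5
        num_induced_class5[OF G])
  also have "\<dots> = (\<Sum>U\<in>Pow (verts G). \<Sum>es\<in>set remaining_reps. equation_coeff i (graph5 es)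
      * of_bool (?iso U es))"
    unfolding sum_distrib_left by (rule sum.swap)
  also have "\<dots> = (\<Sum>U\<in>Pow (verts G). of_bool (\<exists>es\<in>set remaining_reps. ?iso U es) *
      equation_coeff i (induced_subgraph G U))"
  proof (rule sum.cong[OF refl])
    fix U assume "U \<in> Pow (verts G)"
    then have simple: "simple_graph (induced_subgraph G U)" using G
        by (simp add: simple_induced_subgraph)
    show "(\<Sum>es\<in>set remaining_reps. equation_coeff i (graph5 es) * of_bool (?iso U es)) =
      of_bool (\<exists>es\<in>set remaining_reps. ?iso U es) * equation_coeff i (induced_subgraph G U)"
    proof (cases "\<exists>es\<in>set remaining_reps. ?iso U es")
      case True
      then obtain fs where fs: "fs \<in> set remaining_reps" "?iso U fs" by blast
      have "?iso U es \<longleftrightarrow> es = fs" if "es \<in> set remaining_reps" for es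
        using remaining_reps_unique[OF that fs(1)] fs(2) graph_iso_sym graph_iso_trans by blast
      then have "(\<Sum>es\<in>set remaining_reps. equation_coeff i (graph5 es) * of_bool (?iso U es)) =
        (\<Sum>es\<in>set remaining_reps. if es = fs then equation_coeff i (graph5 fs) else 0)"
        by (intro sum.cong refl) auto
      also have "\<dots> = equation_coeff i (graph5 fs)" using fs(1) by simp
      also have "\<dots> = equation_coeff i (induced_subgraph G U)"
        using equation_coeff_iso[OF simple simple_graph5 fs(2)] fs(1) by simp
      finally show ?thesis using True by simp
    qed auto
  qed
  also have "\<dots> = (\<Sum>U\<in>Pow (verts G). of_bool (card U = 5 \<and>
        stable_pair G U \<notin> (\<lambda>ds. stable_pair (graph5 ds) {..<5}) ` set determined_reps) *
      equation_coeff i (induced_subgraph G U))"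
  proof (rule sum.cong[OF refl])
    fix U assume "U \<in> Pow (verts G)"
    then have "simple_graph (induced_subgraph G U)" using G by (simp add: simple_induced_subgraph)
    moreover have "stable_pair (induced_subgraph G U) U = stable_pair G U"
      by (simp add: stable_pair_def stable_count_induced_subgraph)
    ultimately show "of_bool (\<exists>es\<in>set remaining_reps. ?iso U es)
        * equation_coeff i (induced_subgraph G U) =
      of_bool (card U = 5 \<and> stable_pair G U \<notin> (\<lambda>ds. stable_pair (graph5 ds) {..<5}) ` set
          determined_reps) *
      equation_coeff i (induced_subgraph G U)"
      using remaining_iff_stable_pair by fastforce
  qed
  finally show ?thesis .
qed

text \<open>For \<open>i < 10\<close> each summand is a function of the sequence. A deck count is
  not, but its total over all five-element sets is known by double counting; the share of the
  determined types is subtracted, and for these the pair fixes the isomorphism type and thus the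
  deck count.\<close>

lemma kromatic_determines_remaining_sums:
  fixes G :: "'a graph" and G' :: "'b graph"
  assumes G: "simple_graph G" and G': "simple_graph G'" and eq: "kromatic G = kromatic G'"
  shows "(\<Sum>C\<in>remaining_classes5. class_coeff i C * real (num_induced_class C G)) =
    (\<Sum>C\<in>remaining_classes5. class_coeff i C * real (num_induced_class C G'))"
proof -
  define D where "D = (\<lambda>ds. stable_pair (graph5 ds) {..<5}) ` set determined_reps"
  note key = kromatic_determines_stable_counts[OF G G' eq]
  have card1: "card U = stable_count K U 1" if "simple_graph K" "U \<subseteq> verts K"
      for K :: "'c graph" and U
    using that stable_count_1[OF that(1), of U] by (simp add: simple_graph_def finite_subset)
  show ?thesis
  proof (cases "i < 10")
    case True
    have "(\<Sum>C\<in>remaining_classes5. class_coeff i C * real (num_induced_class C K)) =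
      (\<Sum>U\<in>Pow (verts K). (\<lambda>p. of_bool (p 1 = 5 \<and> (p 2, p 3) \<notin> D) * of_bool ((p 2, p 3)
          = remaining_pairs ! i))
        (stable_count K U))" if K: "simple_graph K" for K :: "'c graph"
      unfolding sum_remaining_classes[OF K] D_def[symmetric]
      by (rule sum.cong[OF refl])
        (use True K in \<open>simp add: equation_coeff_def stable_pair_def
            stable_count_induced_subgraph card1\<close>)
    from this[OF G] this[OF G'] key show ?thesis by simp
  next
    case False
    let ?j = "i - 10"
    \<comment> \<open>\<open>h\<close> reads the deck count off a determined representative with the
      given pair. Where no such representative exists the value is arbitrary, but then it is
      multiplied by the zero indicator of \<open>D\<close>.\<close>
    define h where "h p = real (deck_count (graph5 (SOME ds. ds \<in> set determined_reps \<and>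
      stable_pair (graph5 ds) {..<5} = (p 2, p 3))) {..<5} ?j)" for p :: "nat \<Rightarrow> nat"
    have h: "real (deck_count K U ?j) = h (stable_count K U)"
      if K: "simple_graph K" and U: "U \<subseteq> verts K" "card U = 5" "stable_pair K U \<in> D"
          for K :: "'c graph" and U
    proof -
      let ?P = "\<lambda>ds. ds \<in> set determined_reps \<and> stable_pair (graph5 ds) {..<5} = stable_pair K U"
      have "\<exists>ds. ?P ds" using U(3) by (auto simp: D_def)
      then have P: "?P (SOME ds. ?P ds)" by (rule someI_ex)
      have simple: "simple_graph (induced_subgraph K U)" using K U(1)
          by (rule simple_induced_subgraph)
      have "stable_pair (induced_subgraph K U) U = stable_pair K U"
        by (simp add: stable_pair_def stable_count_induced_subgraph)
      with P have "graph_iso (induced_subgraph K U) (graph5 (SOME ds. ?P ds))"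
        using determined_iso_of_stable_pair[OF simple, of "SOME ds. ?P ds"] U(2) by simp
      then have "deck_count (induced_subgraph K U) U = deck_count (graph5 (SOME ds. ?P ds)) {..<5}"
        using graph_iso_counts(2)[OF simple simple_graph5, of "SOME ds. ?P ds"] P by simp
      then show ?thesis
        unfolding h_def deck_count_induced_subgraph by (simp add: stable_pair_def)
    qed
    have "(\<Sum>C\<in>remaining_classes5. class_coeff i C * real (num_induced_class C K)) =
        real (card (verts K) - 4) * (\<Sum>W\<in>Pow (verts K). (\<lambda>p. of_bool (p 1 = 4 \<and> p 2
            = ?j)) (stable_count K W)) -
        (\<Sum>U\<in>Pow (verts K). (\<lambda>p. of_bool (p 1 = 5 \<and> (p 2, p 3) \<in> D) * h p) (stable_count K U))"
      if K: "simple_graph K" for K :: "'c graph"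
    proof -
      have "(\<Sum>C\<in>remaining_classes5. class_coeff i C * real (num_induced_class C K)) =
        (\<Sum>U\<in>Pow (verts K). of_bool (card U = 5) * real (deck_count K U ?j) -
           of_bool (card U = 5 \<and> stable_pair K U \<in> D) * h (stable_count K U))"
        unfolding sum_remaining_classes[OF K] D_def[symmetric]
        by (rule sum.cong[OF refl]) (use False h[OF K] in \<open>auto simp: equation_coeff_def
            deck_count_induced_subgraph\<close>)
      also have "\<dots> = real (card (verts K) - 4) * (\<Sum>W\<in>Pow (verts K). of_bool (card W = 4
          \<and> stable_count K W 2 = ?j)) -
        (\<Sum>U\<in>Pow (verts K). of_bool (card U = 5 \<and> stable_pair K U \<in> D) * h (stable_count K U))"
        by (simp add: sum_subtractf sum_deck_counts[OF K])
      also have "(\<Sum>W\<in>Pow (verts K). of_bool (card W = 4 \<and> stable_count K W 2 = ?j)) =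
          (\<Sum>W\<in>Pow (verts K). (\<lambda>p. of_bool (p 1 = 4 \<and> p 2 = ?j)) (stable_count K W) :: real)"
        by (rule sum.cong[OF refl]) (use K in \<open>simp add: card1\<close>)
      also have "(\<Sum>U\<in>Pow (verts K). of_bool (card U = 5 \<and> stable_pair K U \<in> D)
          * h (stable_count K U)) =
          (\<Sum>U\<in>Pow (verts K). (\<lambda>p. of_bool (p 1 = 5 \<and> (p 2, p 3) \<in> D) * h p) (stable_count K U))"
        by (rule sum.cong[OF refl]) (use K in \<open>simp add: card1 stable_pair_def\<close>)
      finally show ?thesis .
    qed
    note expand = this
    \<comment> \<open>The constant function \<open>1\<close> counts all vertex subsets, so both
      powers of two agree; this fixes the factor from the double counting.\<close>
    have "card (verts G) = card (verts G')"
      using key[of "\<lambda>_. 1"] G G' by (simp add: card_Pow simple_graph_def)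
    then show ?thesis
      using key[of "\<lambda>p. of_bool (p 1 = 4 \<and> p 2 = ?j)"] key[of "\<lambda>p. of_bool (p 1 = 5 \<and> (p 2, p 3)
          \<in> D) * h p"]
      by (simp add: expand[OF G] expand[OF G'])
  qed
qed

theorem theorem1p4:
  shows
    "(\<forall>H\<in>determined_graphs. \<forall>(G :: 'a graph) (G' :: 'b graph).
        simple_graph G \<longrightarrow> simple_graph G' \<longrightarrow> kromatic G = kromatic G' \<longrightarrow>
        num_induced H G = num_induced H G')
   \<and> card remaining_classes5 = 23
   \<and> (\<exists>(A :: ((nat \<Rightarrow>\<^sub>0 nat) \<Rightarrow> nat) \<Rightarrow> nat \<Rightarrow> nat graph set \<Rightarrow> real)
        (b :: ((nat \<Rightarrow>\<^sub>0 nat) \<Rightarrow> nat) \<Rightarrow> nat \<Rightarrow> real).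
        \<forall>G :: 'a graph. simple_graph G \<longrightarrow>
          (\<forall>c :: nat \<Rightarrow> real.
             (\<forall>C\<in>remaining_classes5. (\<Sum>i<14. c i * A (kromatic G) i C) = 0) \<longrightarrow>
             (\<forall>i<14. c i = 0)) \<and>
          (\<forall>i<14. (\<Sum>C\<in>remaining_classes5. A (kromatic G) i C * real (num_induced_class C G))
                  = b (kromatic G) i))
   \<and> (\<forall>(H :: 'c graph) (T :: 'a graph) (T' :: 'b graph).
        simple_graph H \<longrightarrow> card (verts H) \<in> {4, 5} \<longrightarrow>
        tree T \<longrightarrow> tree T' \<longrightarrow> kromatic T = kromatic T' \<longrightarrow>
        num_induced H T = num_induced H T')"
proof (intro conjI)
  show "\<forall>H\<in>determined_graphs. \<forall>(G :: 'a graph) (G' :: 'b graph).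
      simple_graph G \<longrightarrow> simple_graph G' \<longrightarrow> kromatic G = kromatic G' \<longrightarrow>
      num_induced H G = num_induced H G'"
    using determined_num_induced by blast
  show "card remaining_classes5 = 23" by (rule card_remaining_classes5)
  define lhs :: "'a graph \<Rightarrow> nat \<Rightarrow> real" where
    "lhs G i = (\<Sum>C\<in>remaining_classes5. class_coeff i C * real (num_induced_class C G))" for G i
  \<comment> \<open>The right-hand side is computed from an arbitrary graph with symmetric function
    \<open>X\<close>; it does not depend on the choice because graphs with equal symmetric functions
    have equal weighted sums.\<close>
  define b where "b X i = lhs (SOME G. simple_graph G \<and> kromatic G = X) i" for X i
  have b: "b (kromatic G) i = lhs G i" if G: "simple_graph G" for G i
  proof -
    let ?G = "SOME G' :: 'a graph. simple_graph G' \<and> kromatic G' = kromatic G"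
    have "simple_graph ?G \<and> kromatic ?G = kromatic G"
      by (rule someI[of _ G]) (simp add: G)
    then show ?thesis
      unfolding b_def lhs_def using kromatic_determines_remaining_sums G by blast
  qed
  show "\<exists>(A :: ((nat \<Rightarrow>\<^sub>0 nat) \<Rightarrow> nat) \<Rightarrow> nat \<Rightarrow> nat graph set \<Rightarrow> real)
      (b :: ((nat \<Rightarrow>\<^sub>0 nat) \<Rightarrow> nat) \<Rightarrow> nat \<Rightarrow> real).
      \<forall>G :: 'a graph. simple_graph G \<longrightarrow>
        (\<forall>c :: nat \<Rightarrow> real.
           (\<forall>C\<in>remaining_classes5. (\<Sum>i<14. c i * A (kromatic G) i C) = 0) \<longrightarrow>
           (\<forall>i<14. c i = 0)) \<and>
        (\<forall>i<14. (\<Sum>C\<in>remaining_classes5. A (kromatic G) i C * real (num_induced_class C G))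
                = b (kromatic G) i)"
    \<comment> \<open>The coefficient matrix is the same for all graphs; only the right-hand sides
      vary with the symmetric function.\<close>
    using b equation_coeffs_independent
    by (intro exI[of _ "\<lambda>_. class_coeff"] exI[of _ b]) (auto simp: lhs_def)
  show "\<forall>(H :: 'c graph) (T :: 'a graph) (T' :: 'b graph).
      simple_graph H \<longrightarrow> card (verts H) \<in> {4, 5} \<longrightarrow>
      tree T \<longrightarrow> tree T' \<longrightarrow> kromatic T = kromatic T' \<longrightarrow>
      num_induced H T = num_induced H T'"
    using tree_num_induced by blast
qed

end
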